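(* For all permutations $w\in S_n$, $$\mathrm{MC}^\vee(X(w)^\circ)=(-t)^{-\ell(w)}Z^\square_{1_W,w_0w}(\boldsymbol{x};\boldsymbol{y}_{w_0})\qquad\text{and}\qquad \mathrm{MC}^\vee(Y(w)^\circ)=(-t)^{-\ell(w^{-1}w_0)}Z^\square_{1_W,w}(\boldsymbol{x};\boldsymbol{y}).$$
   Context: $W=S_n$, $1_W$ the identity, $s_i=(i,i+1)$, $w_0(i)=n+1-i$, $\ell$ the Coxeter length, $<$ the Bruhat order, products are compositions; $\boldsymbol{y}_{w_0}=(y_n,\dots,y_1)$; $\boldsymbol{x}^{\alpha_i}=x_i/x_{i+1}$; $s_i$ acts on functions of $(\boldsymbol{x};\boldsymbol{y})$ by exchanging $x_i,x_{i+1}$ (fixing $\boldsymbol{y}$); $t$ is an indeterminate. Lifted dual double motivic Chern classes: with $$T_i^\vee=\frac{1-t^{-1}}{\boldsymbol{x}^{\alpha_i}-1}+\frac{-t^{-1}+\boldsymbol{x}^{-\alpha_i}}{\boldsymbol{x}^{-\alpha_i}-1}s_i,$$ (these satisfy the braid relations) they are determined by $\mathrm{MC}^\vee(X(1_W)^\circ)=\prod_{i<j}(1-x_i/y_j)$ and $\mathrm{MC}^\vee(X(ws_i)^\circ)=T_i^\vee\mathrm{MC}^\vee(X(w)^\circ)$ if $ws_i>w$; and $\mathrm{MC}^\vee(Y(w_0)^\circ)=\prod_{i+j\le n}(1-x_i/y_j)$ and $\mathrm{MC}^\vee(Y(ws_i)^\circ)=T_i^\vee\mathrm{MC}^\vee(Y(w)^\circ)$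 if $ws_i<w$. Lattice model ($\square=(n,n-1,\dots,1)$): an $n\times n$ square grid with rows numbered $1,\dots,n$ from top to bottom and columns numbered $1,\dots,n$ from right to left; the vertex in row $i$, column $j$ has parameters $x=x_i$, $y=y_j$. Horizontal edges carry a spin in $\{+,1,\dots,n\}$ ($+$ = uncolored), vertical edges carry a subset of the color set $\{1<\dots<n\}$. The weight of a vertex with left spin $L$, top spin $\Sigma$, right spin $L'$, bottom spin $\Sigma'$, written $(L,\Sigma;L',\Sigma')$, is zero unless listed ($\Sigma_{>c},\Sigma_{<c},\Sigma_{(c,d)}$ denote the elements of $\Sigma$ that are $>c$, $<c$, strictly between $c$ and $d$): (1) $(+,\Sigma;+,\Sigma)$: $(-t)^{|\Sigma|}$. (2) $(c,\Sigma;c,\Sigma)$: $t^{|\Sigma_{>c}|}(-xy^{-1}+t^{\delta})$ with $\delta=1$ if $c\in\Sigma$, else $0$. (3) $(+,\Sigma;c,\Sigma\setminus\{c\})$, $c\in\Sigma$: $(-t)^{|\Sigma_{<c}|}t^{|\Sigma_{>c}|}$. (4) $(c,\Sigma;+,\Sigma\cup\{c\})$, $c\notin\Sigma$: $-(1-t)xy^{-1}(-t)^{|\Sigma_{>c}|}$. (5) $(c,\Sigma;d,(\Sigma\cup\{c\})\setminus\{d\})$, $c<d$, $d\in\Sigma$, $c\notin\Sigma$: $-(1-t)xy^{-1}(-t)^{|\Sigma_{(c,d)}|}t^{|\Sigma_{>d}|}$. (6) $(d,\Sigma;c,(\Sigma\cup\{d\})\setminus\{c\})$, $c<d$, $c\in\Sigma$,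 $d\notin\Sigma$: $-(1-t)(-1)^{|\Sigma_{(c,d)}|}t^{|\Sigma_{>d}|}$. $Z^\square_{\sigma,w}(\boldsymbol{x};\boldsymbol{y})$ is the partition function, i.e. the sum over all assignments of spins to interior edges of the product of the vertex weights, with boundary conditions: the top boundary edge in column $j$ carries the single color $\sigma(j)$; the right boundary edge in row $i$ has color $w(i)$; left and bottom boundary edges are uncolored. *)

theory Defs
  imports "HOL-Combinatorics.Combinatorics" "HOL-Library.FuncSet"
begin

section \<open>The symmetric group\<close>

text \<open>
  Elements of the symmetric group are functions \<open>w\<close> with \<open>w permutes {1..n}\<close>; the product is \<open>\<circ>\<close>,
  the identity is \<open>id\<close>, and the simple reflection \<open>s\<^sub>i\<close> is \<open>transpose i (Suc i)\<close>, \<open>1 \<le> i < n\<close>.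
\<close>

definition coxeter_length :: "nat \<Rightarrow> (nat \<Rightarrow> nat) \<Rightarrow> nat" where
  "coxeter_length n w =
     (LEAST k. \<exists>is. length is = k \<and> set is \<subseteq> {1..<n} \<and>
                    w = foldr (\<lambda>i u. transpose i (Suc i) \<circ> u) is id)"

text \<open>
  \<open>bruhat_step n u v\<close>: \<open>v = u \<circ> r\<close> for a reflection \<open>r\<close> (that is, a transposition) that increases
  the length; the strict Bruhat order is the transitive closure.
\<close>

definition bruhat_step :: "nat \<Rightarrow> (nat \<Rightarrow> nat) \<Rightarrow> (nat \<Rightarrow> nat) \<Rightarrow> bool" where
  "bruhat_step n u v \<longleftrightarrow>
     u permutes {1..n} \<and>
     (\<exists>a\<in>{1..n}. \<exists>b\<in>{1..n}. a \<noteq> b \<and> v = u \<circ> transpose a b) \<and>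
     coxeter_length n u < coxeter_length n v"

definition bruhat_less :: "nat \<Rightarrow> (nat \<Rightarrow> nat) \<Rightarrow> (nat \<Rightarrow> nat) \<Rightarrow> bool" where
  "bruhat_less n = (bruhat_step n)\<^sup>+\<^sup>+"

definition longest_perm :: "nat \<Rightarrow> nat \<Rightarrow> nat" where
  "longest_perm n i = (if i \<in> {1..n} then n + 1 - i else i)"


section \<open>Lifted dual double motivic Chern classes\<close>

text \<open>
  Rational functions of \<open>(x;y)\<close> are represented by their values at points of an arbitrary field
  where the variables \<open>x\<close> are nonzero and pairwise distinct and the variables \<open>y\<close> are nonzero.
  This set of points is stable under permuting the \<open>x\<close>, and no denominator vanishes on it. The
  values of \<open>x\<close> and \<open>y\<close> outside \<open>{1..n}\<close> play no role.
\<close>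

definition generic_point :: "nat \<Rightarrow> (nat \<Rightarrow> 'a::field) \<Rightarrow> (nat \<Rightarrow> 'a) \<Rightarrow> bool" where
  "generic_point n x y \<longleftrightarrow>
     inj_on x {1..n} \<and> (\<forall>i\<in>{1..n}. x i \<noteq> 0) \<and> (\<forall>j\<in>{1..n}. y j \<noteq> 0)"

definition T_dual ::
  "'a::field \<Rightarrow> nat \<Rightarrow> ((nat \<Rightarrow> 'a) \<Rightarrow> (nat \<Rightarrow> 'a) \<Rightarrow> 'a) \<Rightarrow> (nat \<Rightarrow> 'a) \<Rightarrow> (nat \<Rightarrow> 'a) \<Rightarrow> 'a" where
  "T_dual t i f x y =
     (1 - inverse t) / (x i / x (Suc i) - 1) * f x y +
     (- inverse t + x (Suc i) / x i) / (x (Suc i) / x i - 1) * f (x \<circ> transpose i (Suc i)) y"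

text \<open>
  The recursions determine a family of functions on generic points, indexed by permutations. Setting
  the value to \<open>0\<close> elsewhere makes the family unique as a HOL function, so that it can be picked out
  by a definite description.
\<close>

definition is_MC_dual_X ::
  "nat \<Rightarrow> 'a::field \<Rightarrow> ((nat \<Rightarrow> nat) \<Rightarrow> (nat \<Rightarrow> 'a) \<Rightarrow> (nat \<Rightarrow> 'a) \<Rightarrow> 'a) \<Rightarrow> bool" where
  "is_MC_dual_X n t M \<longleftrightarrow>
     (\<forall>x y. generic_point n x y \<longrightarrow>
        M id x y = (\<Prod>(i, j) \<in> {(i, j). 1 \<le> i \<and> i < j \<and> j \<le> n}. 1 - x i / y j)) \<and>
     (\<forall>w i x y. w permutes {1..n} \<longrightarrow> i \<in> {1..<n} \<longrightarrow>
        bruhat_less n w (w \<circ> transpose i (Suc i)) \<longrightarrow> generic_point n x y \<longrightarrow>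
        M (w \<circ> transpose i (Suc i)) x y = T_dual t i (M w) x y) \<and>
     (\<forall>w x y. \<not> (w permutes {1..n} \<and> generic_point n x y) \<longrightarrow> M w x y = 0)"

definition is_MC_dual_Y ::
  "nat \<Rightarrow> 'a::field \<Rightarrow> ((nat \<Rightarrow> nat) \<Rightarrow> (nat \<Rightarrow> 'a) \<Rightarrow> (nat \<Rightarrow> 'a) \<Rightarrow> 'a) \<Rightarrow> bool" where
  "is_MC_dual_Y n t M \<longleftrightarrow>
     (\<forall>x y. generic_point n x y \<longrightarrow>
        M (longest_perm n) x y = (\<Prod>(i, j) \<in> {(i, j). 1 \<le> i \<and> 1 \<le> j \<and> i + j \<le> n}. 1 - x i / y j)) \<and>
     (\<forall>w i x y. w permutes {1..n} \<longrightarrow> i \<in> {1..<n} \<longrightarrow>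
        bruhat_less n (w \<circ> transpose i (Suc i)) w \<longrightarrow> generic_point n x y \<longrightarrow>
        M (w \<circ> transpose i (Suc i)) x y = T_dual t i (M w) x y) \<and>
     (\<forall>w x y. \<not> (w permutes {1..n} \<and> generic_point n x y) \<longrightarrow> M w x y = 0)"

definition MC_dual_X ::
  "nat \<Rightarrow> 'a::field \<Rightarrow> (nat \<Rightarrow> nat) \<Rightarrow> (nat \<Rightarrow> 'a) \<Rightarrow> (nat \<Rightarrow> 'a) \<Rightarrow> 'a" where
  "MC_dual_X n t = (THE M. is_MC_dual_X n t M)"

definition MC_dual_Y ::
  "nat \<Rightarrow> 'a::field \<Rightarrow> (nat \<Rightarrow> nat) \<Rightarrow> (nat \<Rightarrow> 'a) \<Rightarrow> (nat \<Rightarrow> 'a) \<Rightarrow> 'a" where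
  "MC_dual_Y n t = (THE M. is_MC_dual_Y n t M)"


section \<open>The lattice model\<close>

text \<open>
  A horizontal spin is \<open>None\<close> (the uncolored spin \<open>+\<close>) or \<open>Some c\<close>; a vertical spin is a set of
  colors. The arguments of \<open>vertex_weight\<close> after \<open>t x y\<close> are the left, top, right and bottom spins.
\<close>

fun vertex_weight ::
  "'a::field \<Rightarrow> 'a \<Rightarrow> 'a \<Rightarrow> nat option \<Rightarrow> nat set \<Rightarrow> nat option \<Rightarrow> nat set \<Rightarrow> 'a" where
  "vertex_weight t x y None S None S' =
     (if S' = S then (- t) ^ card S else 0)"
| "vertex_weight t x y None S (Some c) S' =
     (if c \<in> S \<and> S' = S - {c}
      then (- t) ^ card {e \<in> S. e < c} * t ^ card {e \<in> S. e > c} else 0)"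
| "vertex_weight t x y (Some c) S None S' =
     (if c \<notin> S \<and> S' = S \<union> {c}
      then - (1 - t) * (x / y) * (- t) ^ card {e \<in> S. e > c} else 0)"
| "vertex_weight t x y (Some a) S (Some b) S' =
     (if a = b then
        (if S' = S
         then t ^ card {e \<in> S. e > a} * (- (x / y) + t ^ (if a \<in> S then 1 else 0)) else 0)
      else if b \<in> S \<and> a \<notin> S \<and> S' = (S \<union> {a}) - {b} then
        (if a < b
         then - (1 - t) * (x / y) * (- t) ^ card {e \<in> S. a < e \<and> e < b} * t ^ card {e \<in> S. e > b}
         else - (1 - t) * (- 1) ^ card {e \<in> S. b < e \<and> e < a} * t ^ card {e \<in> S. e > a})
      else 0)"

text \<open>
  Rows are numbered from top to bottom and columns from right to left. Horizontal edge \<open>(i, k)\<close> of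
  row \<open>i\<close>, \<open>0 \<le> k \<le> n\<close>, is the left edge of the vertex in column \<open>k\<close> and the right edge of the vertex
  in column \<open>k + 1\<close>; vertical edge \<open>(k, j)\<close> of column \<open>j\<close>, \<open>0 \<le> k \<le> n\<close>, is the bottom edge of the
  vertex in row \<open>k\<close> and the top edge of the vertex in row \<open>k + 1\<close>. So an edge is interior iff
  \<open>1 \<le> k < n\<close>. The functions below extend an assignment on interior edges to all edges, by the
  boundary conditions.
\<close>

definition horizontal_spin ::
  "nat \<Rightarrow> (nat \<Rightarrow> nat) \<Rightarrow> (nat \<times> nat \<Rightarrow> nat option) \<Rightarrow> nat \<Rightarrow> nat \<Rightarrow> nat option" where
  "horizontal_spin n w h i k = (if k = 0 then Some (w i) else if k = n then None else h (i, k))"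

definition vertical_spin ::
  "nat \<Rightarrow> (nat \<Rightarrow> nat) \<Rightarrow> (nat \<times> nat \<Rightarrow> nat set) \<Rightarrow> nat \<Rightarrow> nat \<Rightarrow> nat set" where
  "vertical_spin n \<sigma> v k j = (if k = 0 then {\<sigma> j} else if k = n then {} else v (k, j))"

definition partition_function ::
  "nat \<Rightarrow> 'a::field \<Rightarrow> (nat \<Rightarrow> nat) \<Rightarrow> (nat \<Rightarrow> nat) \<Rightarrow> (nat \<Rightarrow> 'a) \<Rightarrow> (nat \<Rightarrow> 'a) \<Rightarrow> 'a" where
  "partition_function n t \<sigma> w x y =
     (\<Sum>h \<in> {1..n} \<times> {1..<n} \<rightarrow>\<^sub>E insert None (Some ` {1..n}).
      \<Sum>v \<in> {1..<n} \<times> {1..n} \<rightarrow>\<^sub>E Pow {1..n}.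
      \<Prod>i\<in>{1..n}. \<Prod>j\<in>{1..n}.
        vertex_weight t (x i) (y j)
          (horizontal_spin n w h i j) (vertical_spin n \<sigma> v (i - 1) j)
          (horizontal_spin n w h i (j - 1)) (vertical_spin n \<sigma> v i j))"

end

theory Submission
  imports Defs
begin

text \<open>
  Both families of motivic classes are pinned down by one initial value and by the recursion
  \<open>T_dual\<close> along length-increasing right multiplications, so it suffices that the partition
  functions, with the stated powers of \<open>-t\<close>, satisfy the same initial condition and the same
  recursion. Writing \<open>Z w\<close> for the partition function with right boundary \<open>w\<close>, and \<open>a = x i\<close>,
  \<open>b = x (i + 1)\<close>, the recursion amounts to
  \<open>(a - t b) Z w (b, a) = (1 - t) b Z w (a, b) + (b - a) Z (w s\<^sub>i) (a, b)\<close> whenever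
  \<open>w (i + 1) < w i\<close>; this is \<open>partition_function_exchange\<close>.

  The exchange relation is a Yang--Baxter argument for two adjacent rows. There is an \<open>R\<close>-matrix
  acting on pairs of horizontal spins (\<open>R_diag\<close> and \<open>R_swap\<close> are its entries) that intertwines the
  products of the two vertices of a column for the two orders of the parameters
  (\<open>yang_baxter_equation\<close>). Pushing it through the columns (\<open>row_exchange\<close>) it meets two uncolored
  edges on the left, where it is the scalar \<open>a - t b\<close>, and two distinct colors on the right, where
  it is the two-term right-hand side above.

  The Yang--Baxter equation involves vertical spins that are arbitrary sets of colors. It becomes a
  finite check because the vertex weights are local: a color \<open>e\<close> of the top edge that differs from the
  left and right spins passes straight through and contributes a factor that is a function of
  \<open>(e, L)\<close> times a function of \<open>(e, R)\<close>. In a product of two vertices this factor depends only on the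
  pair of left spins and the pair of right spins, so it is the same in all four terms of the equation
  and cancels (\<open>yang_baxter_insert\<close>). What is left are vertical spins made of at most four colors,
  where conservation of color allows few configurations.

  The initial condition is a model with a single state: for \<open>w = w\<^sub>0\<close>, row \<open>i\<close> must send the color
  \<open>n + 1 - i\<close> to the right, it can only turn in the column where it enters, and it crosses every
  column to the right of that one once (\<open>grid_longest_perm\<close>). Finally, \<open>Y\<close> is obtained from
  \<open>X\<close> by multiplying \<open>w\<close> by \<open>w\<^sub>0\<close> on the left and reversing \<open>y\<close>, which interchanges the two sets
  of defining recursions (\<open>is_MC_dual_X_opposite\<close>, \<open>is_MC_dual_Y_opposite\<close>).
\<close>

section \<open>Vertex weights as products over colors\<close>

text \<open>
  The only bottom spin that conserves colors, given the other three spins.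
\<close>

definition next_spin :: "nat option \<Rightarrow> nat set \<Rightarrow> nat option \<Rightarrow> nat set" where
  "next_spin L S R = (if L = R then S else (S \<union> set_option L) - set_option R)"

definition conserved :: "nat option \<Rightarrow> nat set \<Rightarrow> nat option \<Rightarrow> nat set \<Rightarrow> bool" where
  "conserved L S R S' \<longleftrightarrow>
     (\<forall>e. of_bool (L = Some e) + of_bool (e \<in> S) = (of_bool (R = Some e) + of_bool (e \<in> S') :: nat))"

lemma vertex_weight_conserved:
  assumes "vertex_weight t x y L S R S' \<noteq> 0"
  shows "conserved L S R S'"
  using assms
  by (cases L; cases R) (auto simp: conserved_def split: if_splits)

lemma conserved_imp_next_spin:
  assumes "conserved L S R S'"
  shows "S' = next_spin L S R"
proof (rule set_eqI)
  fix e
  have "of_bool (L = Some e) + of_bool (e \<in> S) = (of_bool (R = Some e) + of_bool (e \<in> S') :: nat)"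
    using assms by (simp add: conserved_def)
  then show "e \<in> S' \<longleftrightarrow> e \<in> next_spin L S R"
    by (auto simp: next_spin_def of_bool_def split: if_splits)
qed

text \<open>
  A color \<open>e\<close> of the top edge that is different from the left spin \<open>L\<close> and the right spin \<open>R\<close> leaves
  through the bottom edge. Comparing the exponents of \<open>-t\<close>, \<open>t\<close> and \<open>-1\<close> in the six types of vertices
  shows that its contribution to the weight is always
  \<open>spectator_left t e L * spectator_right t e R\<close>. The separation of the dependence on \<open>L\<close> and \<open>R\<close> is
  what makes these colors irrelevant for the Yang--Baxter equation.
\<close>

definition spectator_left :: "'a::field \<Rightarrow> nat \<Rightarrow> nat option \<Rightarrow> 'a" where
  "spectator_left t e L = (case L of None \<Rightarrow> - t | Some c \<Rightarrow> if e < c then 1 else - t)"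

definition spectator_right :: "'a::field \<Rightarrow> nat \<Rightarrow> nat option \<Rightarrow> 'a" where
  "spectator_right t e R = (case R of None \<Rightarrow> 1 | Some c \<Rightarrow> if e < c then 1 else - 1)"

lemma card_filter_insert:
  assumes "finite S" "e \<notin> S"
  shows "card {d. (d = e \<or> d \<in> S) \<and> P d} = of_bool (P e) + card {d \<in> S. P d}"
proof -
  have "{d. (d = e \<or> d \<in> S) \<and> P d} = (if P e then insert e {d \<in> S. P d} else {d \<in> S. P d})"
    by auto
  then show ?thesis using assms by simp
qed

lemma vertex_weight_insert_spectator:
  assumes "finite S" "e \<notin> S" "e \<notin> S'" "L \<noteq> Some e" "R \<noteq> Some e"
  shows "vertex_weight t x y L (insert e S) R (insert e S') =
           spectator_left t e L * spectator_right t e R * vertex_weight t x y L S R S'"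
proof -
  have eq: "insert e S' = insert e A \<longleftrightarrow> S' = A" if "e \<notin> A" for A
    using assms that by (simp add: insert_ident)
  have eqs: "insert e S' = insert e S \<longleftrightarrow> S' = S"
    "c \<noteq> e \<Longrightarrow> insert e S' = insert e (S - {c}) \<longleftrightarrow> S' = S - {c}"
    "c \<noteq> e \<Longrightarrow> insert e S' = insert c (insert e S) \<longleftrightarrow> S' = insert c S"
    "c \<noteq> e \<Longrightarrow> insert e S' = insert e (insert c S - {d}) \<longleftrightarrow> S' = insert c S - {d}" for c d
    using eq[of S] eq[of "S - {c}"] eq[of "insert c S"] eq[of "insert c S - {d}"] assms(2)
    by (simp_all add: insert_commute[of c e] del: insert_Diff_single)
  have diff: "insert e S - {c} = insert e (S - {c})"
    "d \<noteq> e \<Longrightarrow> insert c (insert e S) - {d} = insert e (insert c S - {d})" if "c \<noteq> e" for c d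
    using that by blast+
  show ?thesis
  proof (cases L)
    case None
    show ?thesis
    proof (cases R)
      case None
      show ?thesis
        using assms by (auto simp add: \<open>L = None\<close> None spectator_left_def spectator_right_def eqs(1))
    next
      case (Some d)
      show ?thesis
        using assms by (auto simp add: \<open>L = None\<close> Some spectator_left_def spectator_right_def eqs(2) diff(1) card_filter_insert linorder_neq_iff not_less split: if_splits)
    qed
  next
    case (Some c)
    show ?thesis
    proof (cases R)
      case None
      show ?thesis
        using assms by (auto simp add: \<open>L = Some c\<close> None spectator_left_def spectator_right_def eqs(3) card_filter_insert linorder_neq_iff not_less split: if_splits)
    next
      case (Some d)
      show ?thesis
        using assms by (auto simp add: \<open>L = Some c\<close> Some spectator_left_def spectator_right_def eqs(1,4) diff(2) card_filter_insert linorder_neq_iff not_less split: if_splits)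
    qed
  qed
qed

lemma vertex_weight_spectators:
  assumes "finite E" "finite S" "E \<inter> (S \<union> S') = {}" "E \<inter> (set_option L \<union> set_option R) = {}"
  shows "vertex_weight t x y L (E \<union> S) R (E \<union> S') =
           (\<Prod>e\<in>E. spectator_left t e L * spectator_right t e R) * vertex_weight t x y L S R S'"
  using assms
proof (induction E rule: finite_induct)
  case (insert e E)
  have "vertex_weight t x y L (insert e (E \<union> S)) R (insert e (E \<union> S')) =
      spectator_left t e L * spectator_right t e R * vertex_weight t x y L (E \<union> S) R (E \<union> S')"
    using insert.hyps insert.prems by (intro vertex_weight_insert_spectator) auto
  then show ?case
    using insert by (simp add: mult.assoc)
qed simp

text \<open>
  The weight that remains when all spectators are removed: \<open>S\<close> matters only through the presence of
  the left and right colors.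
\<close>

definition core_weight :: "'a::field \<Rightarrow> 'a \<Rightarrow> nat option \<Rightarrow> nat set \<Rightarrow> nat option \<Rightarrow> 'a" where
  "core_weight t z L S R =
     (case L of
        None \<Rightarrow> (case R of None \<Rightarrow> 1 | Some d \<Rightarrow> if d \<in> S then 1 else 0)
      | Some c \<Rightarrow> (case R of
            None \<Rightarrow> if c \<in> S then 0 else - (1 - t) * z
          | Some d \<Rightarrow>
              if c = d then - z + (if c \<in> S then t else 1)
              else if d \<in> S \<and> c \<notin> S then if c < d then - (1 - t) * z else - (1 - t)
              else 0))"

definition local_weight :: "'a::field \<Rightarrow> 'a \<Rightarrow> nat option \<Rightarrow> nat set \<Rightarrow> nat option \<Rightarrow> 'a" where
  "local_weight t z L S R = core_weight t z L S R *
     (\<Prod>e\<in>S - set_option L - set_option R. spectator_left t e L * spectator_right t e R)"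

lemma vertex_weight_eq_core_weight:
  assumes "U \<subseteq> set_option L \<union> set_option R"
  shows "vertex_weight t x y L U R (next_spin L U R) = core_weight t (x / y) L U R"
proof (cases L)
  case None
  show ?thesis
  proof (cases R)
    case None
    with assms \<open>L = None\<close> show ?thesis by (simp add: core_weight_def next_spin_def)
  next
    case (Some d)
    with assms \<open>L = None\<close> have no: "{e \<in> U. e < d} = {}" "{e \<in> U. d < e} = {}"
      by auto
    from Some \<open>L = None\<close> show ?thesis
      by (simp add: core_weight_def next_spin_def no del: Collect_empty_eq)
  qed
next
  case (Some c)
  show ?thesis
  proof (cases R)
    case None
    with assms \<open>L = Some c\<close> have no: "{e \<in> U. c < e} = {}"
      by auto
    from None \<open>L = Some c\<close> show ?thesis
      by (simp add: core_weight_def next_spin_def no del: Collect_empty_eq)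
  next
    case (Some d)
    with assms \<open>L = Some c\<close> have no: "{e \<in> U. c < e \<and> e < d} = {}" "{e \<in> U. d < e \<and> e < c} = {}"
        "c = d \<or> c < d \<Longrightarrow> {e \<in> U. d < e} = {}" "c = d \<or> d < c \<Longrightarrow> {e \<in> U. c < e} = {}"
      by auto
    show ?thesis
    proof (cases c d rule: linorder_cases)
      case less
      with Some \<open>L = Some c\<close> show ?thesis
        by (simp add: core_weight_def next_spin_def no del: Collect_empty_eq)
    next
      case equal
      with Some \<open>L = Some c\<close> show ?thesis
        using no(3) by (simp add: core_weight_def next_spin_def del: Collect_empty_eq)
    next
      case greater
      with Some \<open>L = Some c\<close> show ?thesis
        by (simp add: core_weight_def next_spin_def no del: Collect_empty_eq)
    qed
  qed
qed

text \<open>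
  The spectators are \<open>S\<close> without the left and right colors; splitting them off leaves the intersection
  of \<open>S\<close> with the left and right colors, where the sets counted by the exponents are empty.
\<close>

lemma vertex_weight_eq_local_weight:
  assumes "finite S"
  shows "vertex_weight t x y L S R S' = (if S' = next_spin L S R then local_weight t (x / y) L S R else 0)"
proof (cases "S' = next_spin L S R")
  case True
  let ?I = "set_option L \<union> set_option R"
  let ?E = "S - set_option L - set_option R"
  have "vertex_weight t x y L (?E \<union> (S \<inter> ?I)) R (?E \<union> (S' \<inter> ?I)) =
      (\<Prod>e\<in>?E. spectator_left t e L * spectator_right t e R) * vertex_weight t x y L (S \<inter> ?I) R (S' \<inter> ?I)"
    using assms by (intro vertex_weight_spectators) auto
  moreover have "?E \<union> (S \<inter> ?I) = S" "?E \<union> (S' \<inter> ?I) = S'"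
    using True by (auto simp: next_spin_def split: if_splits)
  moreover have "vertex_weight t x y L (S \<inter> ?I) R (S' \<inter> ?I) = core_weight t (x / y) L S R"
  proof -
    have "S' \<inter> ?I = next_spin L (S \<inter> ?I) R"
      unfolding True next_spin_def by (cases "L = R") auto
    moreover have "core_weight t (x / y) L (S \<inter> ?I) R = core_weight t (x / y) L S R"
      by (cases L; cases R) (simp_all add: core_weight_def)
    ultimately show ?thesis
      using vertex_weight_eq_core_weight[of "S \<inter> ?I" L R t x y] by simp
  qed
  ultimately show ?thesis
    using True by (simp add: local_weight_def mult.commute)
next
  case False
  then show ?thesis
    using vertex_weight_conserved conserved_imp_next_spin by metis
qed

lemma local_weight_insert:
  assumes "finite S" "e \<notin> S" "L \<noteq> Some e" "R \<noteq> Some e"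
  shows "local_weight t z L (insert e S) R = spectator_left t e L * spectator_right t e R * local_weight t z L S R"
proof -
  have "insert e S - set_option L - set_option R = insert e (S - set_option L - set_option R)"
    using assms by (cases L; cases R) auto
  moreover have "core_weight t z L (insert e S) R = core_weight t z L S R"
    using assms by (auto simp: core_weight_def split: option.splits)
  ultimately show ?thesis
    using assms by (simp add: local_weight_def)
qed

section \<open>The Yang--Baxter equation\<close>

text \<open>
  The \<open>R\<close>-matrix maps a pair \<open>(A, B)\<close> of horizontal spins to itself with coefficient \<open>R_diag\<close> and to
  \<open>(B, A)\<close> with coefficient \<open>R_swap\<close>. It is of \<open>gl(1|n)\<close> type: on equal spins, the roles of \<open>a\<close> and
  \<open>b\<close> for the uncolored spin are opposite to those for the colors. The uncolored spin ranks above all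
  colors in \<open>R_diag\<close> and below all colors in \<open>R_swap\<close>.
\<close>

definition R_diag :: "'a::field \<Rightarrow> 'a \<Rightarrow> 'a \<Rightarrow> nat option \<Rightarrow> nat option \<Rightarrow> 'a" where
  "R_diag t a b A B =
     (case A of
        None \<Rightarrow> (case B of None \<Rightarrow> a - t * b | Some d \<Rightarrow> (1 - t) * b)
      | Some c \<Rightarrow> (case B of None \<Rightarrow> (1 - t) * a
          | Some d \<Rightarrow> if c = d then b - t * a else if c < d then (1 - t) * a else (1 - t) * b))"

definition R_swap :: "'a::field \<Rightarrow> 'a \<Rightarrow> 'a \<Rightarrow> nat option \<Rightarrow> nat option \<Rightarrow> 'a" where
  "R_swap t a b A B =
     (case A of
        None \<Rightarrow> (case B of None \<Rightarrow> 0 | Some d \<Rightarrow> b - a)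
      | Some c \<Rightarrow> (case B of None \<Rightarrow> t * (b - a)
          | Some d \<Rightarrow> if c = d then 0 else if c < d then b - a else t * (b - a)))"

text \<open>
  Two vertices on top of each other, with parameters \<open>a\<close> (top) and \<open>b\<close> (bottom). Conservation of
  color determines the spin of the edge between them, hence there is no sum.
\<close>

definition two_weights ::
  "'a::field \<Rightarrow> 'a \<Rightarrow> 'a \<Rightarrow> nat option \<Rightarrow> nat option \<Rightarrow> nat option \<Rightarrow> nat option \<Rightarrow> nat set \<Rightarrow> 'a"
where
  "two_weights t a b L1 L2 R1 R2 S =
     local_weight t a L1 S R1 * local_weight t b L2 (next_spin L1 S R1) R2"

lemma two_weights_insert:
  assumes "finite S" "e \<notin> S" "L1 \<noteq> Some e" "R1 \<noteq> Some e" "L2 \<noteq> Some e" "R2 \<noteq> Some e"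
  shows "two_weights t a b L1 L2 R1 R2 (insert e S) =
    spectator_left t e L1 * spectator_left t e L2 * (spectator_right t e R1 * spectator_right t e R2) *
    two_weights t a b L1 L2 R1 R2 S"
proof -
  have "next_spin L1 (insert e S) R1 = insert e (next_spin L1 S R1)" "e \<notin> next_spin L1 S R1"
    "finite (next_spin L1 S R1)"
    using assms by (auto simp: next_spin_def)
  then show ?thesis
    using assms by (simp add: two_weights_def local_weight_insert)
qed

text \<open>
  The parameter \<open>z\<close> stands for the inverse of the column parameter. On the left the \<open>R\<close>-matrix acts
  before the two vertices, which have the parameters \<open>b\<close>, \<open>a\<close> from top to bottom; on the right it acts
  after them, and their parameters are \<open>a\<close>, \<open>b\<close>.
\<close>

definition yang_baxter :: "'a::field \<Rightarrow> 'a \<Rightarrow> 'a \<Rightarrow> 'a \<Rightarrow> nat option \<Rightarrow> nat option \<Rightarrow> nat option \<Rightarrow> nat option \<Rightarrow> nat set \<Rightarrow> bool" where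
  "yang_baxter t a b z L1 L2 R1 R2 S \<longleftrightarrow>
     R_diag t a b L1 L2 * two_weights t (b * z) (a * z) L1 L2 R1 R2 S +
     R_swap t a b L1 L2 * two_weights t (b * z) (a * z) L2 L1 R1 R2 S =
     two_weights t (a * z) (b * z) L1 L2 R1 R2 S * R_diag t a b R1 R2 +
     two_weights t (a * z) (b * z) L1 L2 R2 R1 S * R_swap t a b R2 R1"

text \<open>
  All four products acquire the same factor from the new spectator, since it is symmetric in the two
  left spins and in the two right spins.
\<close>

lemma yang_baxter_insert:
  assumes "finite S" "e \<notin> S" "L1 \<noteq> Some e" "R1 \<noteq> Some e" "L2 \<noteq> Some e" "R2 \<noteq> Some e"
    and "yang_baxter t a b z L1 L2 R1 R2 S"
  shows "yang_baxter t a b z L1 L2 R1 R2 (insert e S)"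
proof -
  let ?f = "spectator_left t e L1 * spectator_left t e L2 * (spectator_right t e R1 * spectator_right t e R2)"
  have *: "two_weights t u v L1 L2 R1 R2 (insert e S) = ?f * two_weights t u v L1 L2 R1 R2 S"
     "two_weights t u v L2 L1 R1 R2 (insert e S) = ?f * two_weights t u v L2 L1 R1 R2 S"
     "two_weights t u v L1 L2 R2 R1 (insert e S) = ?f * two_weights t u v L1 L2 R2 R1 S"  for u v
    using assms by (simp_all add: two_weights_insert)
  have "r * (?f * u) + r' * (?f * v) = ?f * (r * u + r' * v)" "(?f * u) * r + (?f * v) * r' = ?f * (u * r + v * r')"
    for r r' u v by algebra+
  then show ?thesis
    using assms(7) by (simp only: yang_baxter_def *)
qed

lemmas yang_baxter_defs = yang_baxter_def two_weights_def local_weight_def core_weight_def next_spin_def R_diag_def R_swap_def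
   spectator_left_def spectator_right_def insert_Diff_if

lemma filter_insert: "{d \<in> insert e S. P d} = (if P e then insert e {d \<in> S. P d} else {d \<in> S. P d})"
  by auto

lemma filter_empty: "{d \<in> {}. P d} = {}"
  by auto

text \<open>
  The remaining checks are organized by the number of colored horizontal spins. Once the relative
  order of all colors involved and their presence on the top edge are fixed, both sides are explicit
  polynomials. The top edge is written as a filter, so that its members can be decided one by one.
\<close>

lemma yang_baxter_no_color: "yang_baxter t a b z None None None None {e \<in> {}. f e}"
  by (simp add: yang_baxter_defs)

lemma yang_baxter_one_color:
  "yang_baxter t a b z None None None (Some p) {e \<in> {p}. f e}"
  "yang_baxter t a b z None None (Some p) None {e \<in> {p}. f e}"
  "yang_baxter t a b z None (Some p) None None {e \<in> {p}. f e}"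
  "yang_baxter t a b z (Some p) None None None {e \<in> {p}. f e}"
  unfolding filter_insert filter_empty
  by (cases "f p"; simp add: yang_baxter_defs; (simp add: algebra_simps)?)+

lemma yang_baxter_two_colors:
  "yang_baxter t a b z None None (Some p) (Some q) {e \<in> {p,q}. f e}"
  "yang_baxter t a b z None (Some p) None (Some q) {e \<in> {p,q}. f e}"
  "yang_baxter t a b z None (Some p) (Some q) None {e \<in> {p,q}. f e}"
  "yang_baxter t a b z (Some p) None None (Some q) {e \<in> {p,q}. f e}"
  "yang_baxter t a b z (Some p) None (Some q) None {e \<in> {p,q}. f e}"
  "yang_baxter t a b z (Some p) (Some q) None None {e \<in> {p,q}. f e}"
  unfolding filter_insert filter_empty
  by (cases p q rule: linorder_cases; cases "f p"; cases "f q"; simp add: yang_baxter_defs; (simp add: algebra_simps)?)+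

text \<open>
  With \<open>b\<close> telling whether the color \<open>e\<close> is on the top edge, conservation prescribes how often \<open>e\<close> must
  occur on the bottom edge; this number must be \<open>0\<close> or \<open>1\<close>.
\<close>

definition balance_possible :: "nat option \<Rightarrow> nat option \<Rightarrow> nat option \<Rightarrow> nat option \<Rightarrow> bool \<Rightarrow> nat \<Rightarrow> bool" where
  "balance_possible L1 L2 R1 R2 b e \<longleftrightarrow>
     of_bool (R1 = Some e) + of_bool (R2 = Some e) \<le> of_bool (L1 = Some e) + of_bool (L2 = Some e) + (of_bool b :: nat) \<and>
     of_bool (L1 = Some e) + of_bool (L2 = Some e) + (of_bool b :: nat) \<le> of_bool (R1 = Some e) + of_bool (R2 = Some e) + 1"

lemma core_weight_conserves:
  assumes "core_weight t z L S R \<noteq> 0"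
  shows "of_bool (L = Some e) + of_bool (e \<in> S) = of_bool (R = Some e) + (of_bool (e \<in> next_spin L S R) :: nat)"
  using assms by (cases L; cases R) (auto simp: core_weight_def next_spin_def of_bool_def split: if_splits)

lemma two_weights_balance:
  assumes "two_weights t a b L1 L2 R1 R2 S \<noteq> 0"
  shows "balance_possible L1 L2 R1 R2 (e \<in> S) e"
proof -
  let ?S = "next_spin L1 S R1"
  have "of_bool (L1 = Some e) + of_bool (e \<in> S) = of_bool (R1 = Some e) + (of_bool (e \<in> ?S) :: nat)"
    "of_bool (L2 = Some e) + of_bool (e \<in> ?S) = of_bool (R2 = Some e) + (of_bool (e \<in> next_spin L2 ?S R2) :: nat)"
    using assms by (intro core_weight_conserves; force simp: two_weights_def local_weight_def)+
  moreover have "of_bool (e \<in> next_spin L2 ?S R2) \<le> (1 :: nat)"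
    by simp
  ultimately show ?thesis
    unfolding balance_possible_def by linarith
qed

text \<open>
  The condition on each color is symmetric in the two left and the two right spins, so if it fails for
  some color, all four products vanish.
\<close>

lemma yang_baxter_balance:
  assumes "(\<And>e. balance_possible L1 L2 R1 R2 (e \<in> S) e) \<Longrightarrow> yang_baxter t a b z L1 L2 R1 R2 S"
  shows "yang_baxter t a b z L1 L2 R1 R2 S"
proof (cases "\<forall>e. balance_possible L1 L2 R1 R2 (e \<in> S) e")
  case False
  then obtain e where "\<not> balance_possible L1 L2 R1 R2 (e \<in> S) e" by blast
  then have "\<not> balance_possible L2 L1 R1 R2 (e \<in> S) e" "\<not> balance_possible L1 L2 R2 R1 (e \<in> S) e" "\<not> balance_possible L1 L2 R1 R2 (e \<in> S) e"
    by (auto simp: balance_possible_def add.commute)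
  then show ?thesis
    unfolding yang_baxter_def using two_weights_balance by (metis add_0 mult_zero_left mult_zero_right)
qed (use assms in blast)

text \<open>
  The configurations that violate conservation are discarded before the polynomials are compared,
  because the number of cases is considerable.
\<close>

lemma yang_baxter_three_colors:
  "yang_baxter t a b z None (Some p) (Some q) (Some r) {e \<in> {p,q,r}. f e}"
  "yang_baxter t a b z (Some p) None (Some q) (Some r) {e \<in> {p,q,r}. f e}"
  "yang_baxter t a b z (Some p) (Some q) None (Some r) {e \<in> {p,q,r}. f e}"
  "yang_baxter t a b z (Some p) (Some q) (Some r) None {e \<in> {p,q,r}. f e}"
proof -
  have *: "yang_baxter t a b z L1 L2 R1 R2 {e \<in> {p,q,r}. f e}"
    if "balance_possible L1 L2 R1 R2 (f p) p \<Longrightarrow> balance_possible L1 L2 R1 R2 (f q) q \<Longrightarrow>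
      balance_possible L1 L2 R1 R2 (f r) r \<Longrightarrow> yang_baxter t a b z L1 L2 R1 R2 {e \<in> {p,q,r}. f e}" for L1 L2 R1 R2
  proof (rule yang_baxter_balance)
    assume h: "\<And>e. balance_possible L1 L2 R1 R2 (e \<in> {e \<in> {p,q,r}. f e}) e"
    show "yang_baxter t a b z L1 L2 R1 R2 {e \<in> {p,q,r}. f e}"
      by (rule that) (use h[of p] h[of q] h[of r] in simp_all)
  qed
  show "yang_baxter t a b z None (Some p) (Some q) (Some r) {e \<in> {p,q,r}. f e}"
  "yang_baxter t a b z (Some p) None (Some q) (Some r) {e \<in> {p,q,r}. f e}"
  "yang_baxter t a b z (Some p) (Some q) None (Some r) {e \<in> {p,q,r}. f e}"
  "yang_baxter t a b z (Some p) (Some q) (Some r) None {e \<in> {p,q,r}. f e}"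
  \<comment> \<open>\<open>linarith\<close> removes cyclic orders of the colors, the first \<open>simp\<close> violations of conservation.\<close>
  by (rule *; unfold filter_insert filter_empty;
      cases p q rule: linorder_cases; cases q r rule: linorder_cases; cases p r rule: linorder_cases; (linarith)?;
      cases "f p"; cases "f q"; cases "f r"; (simp add: balance_possible_def; fail)?;
      simp add: yang_baxter_defs; (simp add: algebra_simps)?)+
qed

text \<open>
  If all four horizontal spins are colored, conservation leaves only the following types, sorted by
  the number of distinct colors among these spins.
\<close>

lemma yang_baxter_one_of_four: "yang_baxter t a b z (Some p) (Some p) (Some p) (Some p) {e \<in> {p}. f e}"
  unfolding filter_insert filter_empty by (cases "f p"; simp add: yang_baxter_defs)

lemma yang_baxter_two_of_four:
  assumes "p \<noteq> q"
  shows "yang_baxter t a b z (Some p) (Some p) (Some p) (Some q) {q}"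
    "yang_baxter t a b z (Some p) (Some p) (Some q) (Some p) {q}"
    "yang_baxter t a b z (Some p) (Some q) (Some p) (Some p) {p}"
    "yang_baxter t a b z (Some q) (Some p) (Some p) (Some p) {p}"
    "yang_baxter t a b z (Some p) (Some q) (Some p) (Some q) {e \<in> {p, q}. f e}"
    "yang_baxter t a b z (Some p) (Some q) (Some q) (Some p) {e \<in> {p, q}. f e}"
  using assms unfolding filter_insert filter_empty
  by (elim linorder_neqE_nat; cases "f p"; cases "f q"; simp add: yang_baxter_defs; (simp add: algebra_simps)?)+

lemma yang_baxter_three_of_four:
  assumes "p \<noteq> q" "q \<noteq> r" "p \<noteq> r"
  shows "yang_baxter t a b z (Some p) (Some q) (Some p) (Some r) {r}"
    "yang_baxter t a b z (Some p) (Some q) (Some p) (Some r) {p, r}"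
    "yang_baxter t a b z (Some p) (Some q) (Some r) (Some p) {r}"
    "yang_baxter t a b z (Some p) (Some q) (Some r) (Some p) {p, r}"
    "yang_baxter t a b z (Some q) (Some p) (Some p) (Some r) {r}"
    "yang_baxter t a b z (Some q) (Some p) (Some p) (Some r) {p, r}"
    "yang_baxter t a b z (Some q) (Some p) (Some r) (Some p) {r}"
    "yang_baxter t a b z (Some q) (Some p) (Some r) (Some p) {p, r}"
  using assms
  by (elim linorder_neqE_nat; (linarith)?; simp add: yang_baxter_defs; (simp add: algebra_simps)?)+

lemma yang_baxter_four_distinct:
  assumes "p \<noteq> q" "r \<noteq> s" "p \<noteq> r" "p \<noteq> s" "q \<noteq> r" "q \<noteq> s"
  shows "yang_baxter t a b z (Some p) (Some q) (Some r) (Some s) {r, s}"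
  using assms
  by (elim linorder_neqE_nat; (linarith)?; simp add: yang_baxter_defs; (simp add: algebra_simps)?)

text \<open>
  A color on exactly one left edge and no right edge must be missing from the top edge, and a color
  on exactly one right edge and no left edge must be present there; this sorts every admissible
  configuration into one of the types above.
\<close>

lemma yang_baxter_four_colors:
  "yang_baxter t a b z (Some p) (Some q) (Some r) (Some s) {e \<in> {p,q,r,s}. f e}" (is "yang_baxter t a b z ?L1 ?L2 ?R1 ?R2 ?S")
proof (rule yang_baxter_balance)
  assume h: "balance_possible ?L1 ?L2 ?R1 ?R2 (e \<in> ?S) e" for e
  have *: "balance_possible ?L1 ?L2 ?R1 ?R2 (f p) p" "balance_possible ?L1 ?L2 ?R1 ?R2 (f q) q"
       "balance_possible ?L1 ?L2 ?R1 ?R2 (f r) r" "balance_possible ?L1 ?L2 ?R1 ?R2 (f s) s"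
    using h[of p] h[of q] h[of r] h[of s] by simp_all
  show "yang_baxter t a b z ?L1 ?L2 ?R1 ?R2 ?S"
  proof (cases "p = q")
    case pq: True
    show ?thesis
    proof (cases "r = s")
      case rs: True
      then have "p = r" using * pq by (cases "p = r") (auto simp: balance_possible_def Suc_le_eq)
      then show ?thesis using pq rs yang_baxter_one_of_four by simp
    next
      case False
      consider "r = p" "s \<noteq> p" | "s = p" "r \<noteq> p" | "r \<noteq> p" "s \<noteq> p"
        using False by blast
      then show ?thesis
      proof cases
        case 1
        then have "\<not> f p" "f s" using * pq by (auto simp: balance_possible_def Suc_le_eq)
        then have "?S = {s}" using 1 pq by auto
        then show ?thesis using 1 pq yang_baxter_two_of_four(1)[of p s] by simp
      next
        case 2
        then have "\<not> f p" "f r" using * pq by (auto simp: balance_possible_def Suc_le_eq)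
        then have "?S = {r}" using 2 pq by auto
        then show ?thesis using 2 pq yang_baxter_two_of_four(2)[of p r] by simp
      next
        case 3
        then show ?thesis using * pq by (cases "f p") (simp_all add: balance_possible_def)
      qed
    qed
  next
    case pq: False
    show ?thesis
    proof (cases "r = s")
      case rs: True
      consider "p = r" "q \<noteq> r" | "q = r" "p \<noteq> r" | "p \<noteq> r" "q \<noteq> r"
        using pq by blast
      then show ?thesis
      proof cases
        case 1
        then have "f r" "\<not> f q" using * rs by (auto simp: balance_possible_def Suc_le_eq)
        then have "?S = {r}" using 1 rs by auto
        then show ?thesis using 1 rs yang_baxter_two_of_four(3)[of p q] by simp
      next
        case 2
        then have "f r" "\<not> f p" using * rs by (auto simp: balance_possible_def Suc_le_eq)
        then have "?S = {r}" using 2 rs by auto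
        then show ?thesis using 2 rs yang_baxter_two_of_four(4)[of q p] by simp
      next
        case 3
        then show ?thesis using * rs by (cases "f s") (simp_all add: balance_possible_def)
      qed
    next
      case rs: False
      consider "p = r" "q = s" | "p = s" "q = r" | "p = r" "q \<noteq> s" | "p = s" "q \<noteq> r"
        | "q = r" "p \<noteq> s" | "q = s" "p \<noteq> r" | "p \<noteq> r" "p \<noteq> s" "q \<noteq> r" "q \<noteq> s"
        by blast
      then show ?thesis
      proof cases
        case 1
        have "?S = {e \<in> {p, q}. f e}" using 1 by auto
        then show ?thesis using 1 pq yang_baxter_two_of_four(5)[of p q t a b z f] by simp
      next
        case 2
        have "?S = {e \<in> {p, q}. f e}" using 2 by auto
        then show ?thesis using 2 pq yang_baxter_two_of_four(6)[of p q t a b z f] by simp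
      next
        case 3
        then have "f s" "\<not> f q" using * pq rs by (auto simp: balance_possible_def Suc_le_eq)
        then have "?S = (if f p then {p, s} else {s})" using 3 by auto
        then show ?thesis using 3 pq rs yang_baxter_three_of_four(1,2)[of p q s] by auto
      next
        case 4
        then have "f r" "\<not> f q" using * pq rs by (auto simp: balance_possible_def Suc_le_eq)
        then have "?S = (if f p then {p, r} else {r})" using 4 by auto
        then show ?thesis using 4 pq rs yang_baxter_three_of_four(3,4)[of p q r] by auto
      next
        case 5
        then have "f s" "\<not> f p" using * pq rs by (auto simp: balance_possible_def Suc_le_eq)
        then have "?S = (if f q then {q, s} else {s})" using 5 by auto
        then show ?thesis using 5 pq rs yang_baxter_three_of_four(5,6)[of q p s] by auto
      next
        case 6
        then have "f r" "\<not> f p" using * pq rs by (auto simp: balance_possible_def Suc_le_eq)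
        then have "?S = (if f q then {q, r} else {r})" using 6 by auto
        then show ?thesis using 6 pq rs yang_baxter_three_of_four(7,8)[of q p r] by auto
      next
        case 7
        then have "f r" "f s" "\<not> f p" "\<not> f q" using * pq rs by (simp_all add: balance_possible_def Suc_le_eq)
        then have "?S = {r, s}" by auto
        then show ?thesis using 7 pq rs yang_baxter_four_distinct[of p q r s] by simp
      qed
    qed
  qed
qed

lemma yang_baxter_spectators:
  assumes "finite E" "finite S" "E \<inter> S = {}"
    "E \<inter> (set_option L1 \<union> set_option L2 \<union> set_option R1 \<union> set_option R2) = {}"
    and "yang_baxter t a b z L1 L2 R1 R2 S"
  shows "yang_baxter t a b z L1 L2 R1 R2 (E \<union> S)"
  using assms
proof (induction E rule: finite_induct)
  case (insert e E)
  then have "yang_baxter t a b z L1 L2 R1 R2 (insert e (E \<union> S))"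
    by (intro yang_baxter_insert) auto
  then show ?case by simp
qed simp

lemma yang_baxter_equation:
  assumes "finite S"
  shows "yang_baxter t a b z L1 L2 R1 R2 S"
proof -
  let ?I = "set_option L1 \<union> set_option L2 \<union> set_option R1 \<union> set_option R2"
  have "yang_baxter t a b z L1 L2 R1 R2 {e \<in> ?I. e \<in> S}"
    by (cases L1; cases L2; cases R1; cases R2;
        simp only: option.set Un_insert_left Un_empty_left Un_empty_right)
      (rule yang_baxter_no_color yang_baxter_one_color yang_baxter_two_colors yang_baxter_three_colors yang_baxter_four_colors)+
  then have "yang_baxter t a b z L1 L2 R1 R2 ((S - ?I) \<union> {e \<in> ?I. e \<in> S})"
    using assms by (intro yang_baxter_spectators) auto
  moreover have "(S - ?I) \<union> {e \<in> ?I. e \<in> S} = S" by blast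
  ultimately show ?thesis by simp
qed

section \<open>Partition functions as iterated transfer matrices\<close>

text \<open>
  The sum over all paths \<open>p = r\<^sub>0, r\<^sub>1, \<dots>, r\<^sub>k = q\<close> in \<open>Q\<close> of the products of the step weights
  \<open>G i r\<^sub>i\<^sub>-\<^sub>1 r\<^sub>i\<close>. The same recursion serves for the columns of a row and for the rows of the grid.
\<close>

primrec chain :: "(nat \<Rightarrow> 's \<Rightarrow> 's \<Rightarrow> 'a::comm_ring_1) \<Rightarrow> 's set \<Rightarrow> 's \<Rightarrow> nat \<Rightarrow> 's \<Rightarrow> 'a" where
  "chain G Q p 0 q = of_bool (p = q)"
| "chain G Q p (Suc k) q = (\<Sum>r\<in>Q. chain G Q p k r * G (Suc k) r q)"

lemma sum_PiE_insert:
  assumes "finite A" "a \<notin> A" "\<And>x. x \<in> insert a A \<Longrightarrow> finite (B x)"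
  shows "(\<Sum>f\<in>PiE (insert a A) B. F f) = (\<Sum>y\<in>B a. \<Sum>g\<in>PiE A B. F (g(a := y)))"
proof -
  have "(\<Sum>f\<in>PiE (insert a A) B. F f) = (\<Sum>(y, g)\<in>B a \<times> PiE A B. F (g(a := y)))"
    unfolding PiE_insert_eq using assms(2)
    by (subst sum.reindex[OF inj_combinator]) (auto intro!: sum.cong)
  then show ?thesis
    by (simp add: sum.cartesian_product)
qed

text \<open>
  The path is represented as in the boundary conventions of the lattice model: \<open>f\<close> lists the interior
  points, and the two ends are filled in by case distinctions.
\<close>

lemma sum_over_paths:
  fixes G :: "nat \<Rightarrow> 's \<Rightarrow> 's \<Rightarrow> 'a::comm_ring_1"
  assumes "finite Q" "p \<in> Q"
  shows "(\<Sum>f\<in>{1..<Suc m} \<rightarrow>\<^sub>E Q. \<Prod>i\<in>{1..Suc m}.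
            G i (if i - 1 = 0 then p else if i - 1 = Suc m then q else f (i - 1))
                (if i = 0 then p else if i = Suc m then q else f i)) =
         chain G Q p (Suc m) q"
proof (induction m arbitrary: q)
  case 0
  have "chain G Q p (Suc 0) q = (\<Sum>r\<in>Q. if p = r then G 1 r q else 0)"
    by (auto intro!: sum.cong)
  then show ?case using assms by simp
next
  case (Suc m)
  let ?path = "\<lambda>m q f i. if i = 0 then p else if i = Suc m then q else f i"
  have "(\<Prod>i\<in>{1..Suc (Suc m)}. G i (?path (Suc m) q (f(Suc m := r)) (i - 1)) (?path (Suc m) q (f(Suc m := r)) i)) =
     (\<Prod>i\<in>{1..Suc m}. G i (?path m r f (i - 1)) (?path m r f i)) * G (Suc (Suc m)) r q" for f r
  proof -
    have "(\<Prod>i\<in>{1..Suc m}. G i (?path (Suc m) q (f(Suc m := r)) (i - 1)) (?path (Suc m) q (f(Suc m := r)) i)) =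
     (\<Prod>i\<in>{1..Suc m}. G i (?path m r f (i - 1)) (?path m r f i))"
      by (intro prod.cong) auto
    then show ?thesis by simp
  qed
  moreover have "{1..<Suc (Suc m)} = insert (Suc m) {1..<Suc m}" by auto
  ultimately show ?case
    using Suc.IH assms by (simp add: sum_PiE_insert flip: sum_distrib_right)
qed

lemma sum_PiE_curry:
  "(\<Sum>h\<in>I \<times> J \<rightarrow>\<^sub>E A. F h) = (\<Sum>V\<in>I \<rightarrow>\<^sub>E (J \<rightarrow>\<^sub>E A). F (\<lambda>p\<in>I \<times> J. V (fst p) (snd p)))"
  by (rule sum.reindex_bij_witness[where i = "\<lambda>V. \<lambda>p\<in>I \<times> J. V (fst p) (snd p)"
        and j = "\<lambda>h. \<lambda>i\<in>I. \<lambda>j\<in>J. h (i, j)"])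
    (auto simp: PiE_iff extensional_def fun_eq_iff restrict_def intro!: arg_cong[where f = F])

definition horizontal_spins :: "nat \<Rightarrow> nat option set" where
  "horizontal_spins n = insert None (Some ` {1..n})"

text \<open>
  Partition function of the columns \<open>1, \<dots>, k\<close> of a row, built from right to left: \<open>R\<close> is the spin at
  the right end and the last argument is the spin at the left end.
\<close>

definition row :: "nat \<Rightarrow> 'a::field \<Rightarrow> (nat \<Rightarrow> 'a) \<Rightarrow> 'a \<Rightarrow> nat option \<Rightarrow> (nat \<Rightarrow> nat set) \<Rightarrow> (nat \<Rightarrow> nat set) \<Rightarrow> nat \<Rightarrow> nat option \<Rightarrow> 'a" where
  "row n t y x R S S' = chain (\<lambda>j R L. vertex_weight t x (y j) L (S j) R (S' j)) (horizontal_spins n) R"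

text \<open>
  Partition function of the first \<open>k\<close> rows, with the family of vertical spins below row \<open>k\<close> as its
  last argument.
\<close>

definition grid :: "nat \<Rightarrow> 'a::field \<Rightarrow> (nat \<Rightarrow> nat) \<Rightarrow> (nat \<Rightarrow> nat) \<Rightarrow> (nat \<Rightarrow> 'a) \<Rightarrow> (nat \<Rightarrow> 'a) \<Rightarrow> nat \<Rightarrow> (nat \<Rightarrow> nat set) \<Rightarrow> 'a" where
  "grid n t \<sigma> w x y =
     chain (\<lambda>i S S'. row n t y (x i) (Some (w i)) S S' n None) ({1..n} \<rightarrow>\<^sub>E Pow {1..n}) (\<lambda>j\<in>{1..n}. {\<sigma> j})"

lemma chain_cong:
  assumes "\<And>i r q. i \<in> {1..k} \<Longrightarrow> G i r q = G' i r q"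
  shows "chain G Q p k q = chain G' Q p k q"
  using assms
proof (induction k arbitrary: q)
  case (Suc k)
  then have "chain G Q p k r = chain G' Q p k r" for r by auto
  then show ?case using Suc.prems by simp
qed simp

lemma row_cong:
  assumes "\<And>j. j \<in> {1..k} \<Longrightarrow> S j = U j" "\<And>j. j \<in> {1..k} \<Longrightarrow> S' j = U' j"
  shows "row n t y x R S S' k L = row n t y x R U U' k L"
  unfolding row_def using assms by (intro chain_cong) simp

lemma row_eq_sum:
  assumes "R \<in> horizontal_spins n"
  shows "(\<Sum>g\<in>{1..<Suc m} \<rightarrow>\<^sub>E horizontal_spins n. \<Prod>j\<in>{1..Suc m}.
           vertex_weight t x (y j)
             (if j = 0 then R else if j = Suc m then L else g j) (S j)
             (if j - 1 = 0 then R else if j - 1 = Suc m then L else g (j - 1)) (S' j)) =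
         row n t y x R S S' (Suc m) L"
  unfolding row_def using assms
  by (subst sum_over_paths[symmetric]) (simp_all add: horizontal_spins_def)

text \<open>
  For fixed vertical spins the rows are independent, so the sum over the horizontal spins is a product
  of sums, one for each row; the sum over the vertical spins is then a sum over paths of length \<open>n\<close>.
\<close>

lemma partition_function_eq_grid:
  assumes n: "n = Suc m" and w: "w permutes {1..n}" and \<sigma>: "\<sigma> permutes {1..n}"
  shows "partition_function n t \<sigma> w x y = grid n t \<sigma> w x y n (\<lambda>j\<in>{1..n}. {})"
proof -
  let ?H = "horizontal_spins n" and ?Q = "{1..n} \<rightarrow>\<^sub>E Pow {1..n}"
  define F where "F g v i = (\<Prod>j\<in>{1..n}.
         vertex_weight t (x i) (y j)
           (if j = 0 then Some (w i) else if j = n then None else g j) (vertical_spin n \<sigma> v (i - 1) j)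
           (if j - 1 = 0 then Some (w i) else if j - 1 = n then None else g (j - 1)) (vertical_spin n \<sigma> v i j))"
    for g v i
  define path where
    "path V k = (if k = 0 then (\<lambda>j\<in>{1..n}. {\<sigma> j}) else if k = n then (\<lambda>j\<in>{1..n}. {}) else V k)"
    for V k
  have H: "Some (w i) \<in> ?H" if "i \<in> {1..n}" for i
    unfolding horizontal_spins_def using permutes_in_image[OF w, of i] that by blast
  have fin: "finite ?H" "finite ?Q"
    by (auto simp: horizontal_spins_def intro!: finite_PiE)
  have F: "(\<Prod>j\<in>{1..n}.
        vertex_weight t (x i) (y j)
          (horizontal_spin n w h i j) (vertical_spin n \<sigma> v (i - 1) j)
          (horizontal_spin n w h i (j - 1)) (vertical_spin n \<sigma> v i j)) = F (\<lambda>k. h (i, k)) v i" for h v i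
    unfolding F_def horizontal_spin_def by (rule prod.cong) auto
  \<comment> \<open>Currying makes the horizontal spins \<open>undefined\<close> at the two ends of a row, where \<open>F\<close> uses the boundary.\<close>
  have F_restrict: "F (\<lambda>k. if k \<in> {1..<n} then g k else undefined) v i = F g v i" for g v i
    unfolding F_def by (intro prod.cong refl) auto
  have "partition_function n t \<sigma> w x y =
      (\<Sum>h \<in> {1..n} \<times> {1..<n} \<rightarrow>\<^sub>E ?H. \<Sum>v \<in> {1..<n} \<times> {1..n} \<rightarrow>\<^sub>E Pow {1..n}. \<Prod>i\<in>{1..n}. F (\<lambda>k. h (i, k)) v i)"
    unfolding partition_function_def F horizontal_spins_def ..
  also have "\<dots> = (\<Sum>v \<in> {1..<n} \<times> {1..n} \<rightarrow>\<^sub>E Pow {1..n}. \<Sum>h \<in> {1..n} \<times> {1..<n} \<rightarrow>\<^sub>E ?H. \<Prod>i\<in>{1..n}. F (\<lambda>k. h (i, k)) v i)"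
    by (rule sum.swap)
  also have "\<dots> = (\<Sum>v \<in> {1..<n} \<times> {1..n} \<rightarrow>\<^sub>E Pow {1..n}. \<Prod>i\<in>{1..n}. \<Sum>g\<in>{1..<n} \<rightarrow>\<^sub>E ?H. F g v i)"
  proof (rule sum.cong[OF refl])
    fix v
    have "(\<Sum>h \<in> {1..n} \<times> {1..<n} \<rightarrow>\<^sub>E ?H. \<Prod>i\<in>{1..n}. F (\<lambda>k. h (i, k)) v i) =
       (\<Sum>V\<in>{1..n} \<rightarrow>\<^sub>E ({1..<n} \<rightarrow>\<^sub>E ?H). \<Prod>i\<in>{1..n}. F (V i) v i)"
      unfolding sum_PiE_curry
    proof (intro sum.cong prod.cong refl)
      fix V :: "nat \<Rightarrow> nat \<Rightarrow> nat option" and i assume "i \<in> {1..n}"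
      then have "(\<lambda>k. (\<lambda>p\<in>{1..n} \<times> {1..<n}. V (fst p) (snd p)) (i, k)) =
          (\<lambda>k. if k \<in> {1..<n} then V i k else undefined)"
        by (auto simp: restrict_def)
      then show "F (\<lambda>k. (\<lambda>p\<in>{1..n} \<times> {1..<n}. V (fst p) (snd p)) (i, k)) v i = F (V i) v i"
        by (simp only: F_restrict)
    qed
    also have "\<dots> = (\<Prod>i\<in>{1..n}. \<Sum>g\<in>{1..<n} \<rightarrow>\<^sub>E ?H. F g v i)"
      using fin by (subst prod_sum_PiE) (auto intro!: finite_PiE)
    finally show "(\<Sum>h \<in> {1..n} \<times> {1..<n} \<rightarrow>\<^sub>E ?H. \<Prod>i\<in>{1..n}. F (\<lambda>k. h (i, k)) v i) =
      (\<Prod>i\<in>{1..n}. \<Sum>g\<in>{1..<n} \<rightarrow>\<^sub>E ?H. F g v i)" .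
  qed
  also have "\<dots> = (\<Sum>v \<in> {1..<n} \<times> {1..n} \<rightarrow>\<^sub>E Pow {1..n}. \<Prod>i\<in>{1..n}.
       row n t y (x i) (Some (w i)) (vertical_spin n \<sigma> v (i - 1)) (vertical_spin n \<sigma> v i) n None)"
  proof (intro sum.cong prod.cong refl)
    fix v i assume "i \<in> {1..n}"
    then show "(\<Sum>g\<in>{1..<n} \<rightarrow>\<^sub>E ?H. F g v i) =
        row n t y (x i) (Some (w i)) (vertical_spin n \<sigma> v (i - 1)) (vertical_spin n \<sigma> v i) n None"
      unfolding F_def n by (rule row_eq_sum[OF H[unfolded n]])
  qed
  also have "\<dots> = (\<Sum>V\<in>{1..<n} \<rightarrow>\<^sub>E ?Q. \<Prod>i\<in>{1..n}.
       row n t y (x i) (Some (w i)) (path V (i - 1)) (path V i) n None)"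
    unfolding sum_PiE_curry
    by (intro sum.cong prod.cong refl row_cong) (auto simp: vertical_spin_def path_def)
  also have "\<dots> = grid n t \<sigma> w x y n (\<lambda>j\<in>{1..n}. {})"
    unfolding grid_def path_def n
  proof (rule sum_over_paths)
    show "(\<lambda>j\<in>{1..Suc m}. {\<sigma> j}) \<in> {1..Suc m} \<rightarrow>\<^sub>E Pow {1..Suc m}"
      using permutes_in_image[OF \<sigma>] by (auto simp: n)
  qed (auto intro!: finite_PiE)
  finally show ?thesis .
qed

section \<open>Lengths, inversions and the Bruhat order\<close>

abbreviation simple_reflection :: "nat \<Rightarrow> nat \<Rightarrow> nat" where
  "simple_reflection i \<equiv> transpose i (Suc i)"

definition inversions :: "nat \<Rightarrow> (nat \<Rightarrow> nat) \<Rightarrow> (nat \<times> nat) set" where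
  "inversions n w = {(a, b). 1 \<le> a \<and> a < b \<and> b \<le> n \<and> w b < w a}"

lemma inversions_id [simp]: "inversions n id = {}" "inversions n (\<lambda>a. a) = {}"
  by (auto simp: inversions_def)

lemma finite_inversions: "finite (inversions n w)"
  by (rule finite_subset[of _ "{1..n} \<times> {1..n}"]) (auto simp: inversions_def)

lemma permutes_compose_simple_reflection:
  assumes "w permutes {1..n}" "i \<in> {1..<n}"
  shows "w \<circ> simple_reflection i permutes {1..n}"
  using assms by (intro permutes_compose permutes_swap_id) auto

text \<open>
  A simple reflection permutes all pairs of positions except \<open>(i, i + 1)\<close> without changing which
  position comes first, so it maps old inversions to inversions and creates exactly one.
\<close>

lemma card_inversions_ascent:
  assumes i: "i \<in> {1..<n}" and asc: "w i < w (Suc i)"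
  shows "card (inversions n (w \<circ> simple_reflection i)) = Suc (card (inversions n w))"
proof -
  let ?s = "simple_reflection i" and ?f = "\<lambda>(a, b). (simple_reflection i a, simple_reflection i b)"
  have range: "1 \<le> ?s a \<and> ?s a \<le> n \<longleftrightarrow> 1 \<le> a \<and> a \<le> n" for a
    using i by (auto simp: transpose_def)
  have mono: "?s a < ?s b \<longleftrightarrow> a < b" if "(a, b) \<noteq> (i, Suc i)" "(a, b) \<noteq> (Suc i, i)" for a b
    using that by (auto simp: transpose_def split: if_splits)
  have "inversions n (w \<circ> ?s) = insert (i, Suc i) (?f ` inversions n w)"
  proof (intro set_eqI iffI)
    fix p assume p: "p \<in> inversions n (w \<circ> ?s)"
    obtain a b where ab: "p = (a, b)" by fastforce
    show "p \<in> insert (i, Suc i) (?f ` inversions n w)"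
    proof (cases "p = (i, Suc i)")
      case False
      then have "(?s a, ?s b) \<in> inversions n w"
        using p mono[of a b] range[of a] range[of b] by (auto simp: ab inversions_def)
      then have "?f (?s a, ?s b) \<in> ?f ` inversions n w" by (rule imageI)
      then show ?thesis by (simp add: ab)
    qed simp
  next
    fix p assume "p \<in> insert (i, Suc i) (?f ` inversions n w)"
    then consider "p = (i, Suc i)" | a b where "(a, b) \<in> inversions n w" "p = (?s a, ?s b)" by auto
    then show "p \<in> inversions n (w \<circ> ?s)"
    proof cases
      case 1
      then show ?thesis using i asc by (simp add: inversions_def)
    next
      case 2
      then have "(a, b) \<noteq> (i, Suc i)" "(a, b) \<noteq> (Suc i, i)"
        using asc by (auto simp: inversions_def)
      then show ?thesis
        using 2 mono[of a b] range[of a] range[of b] by (auto simp: inversions_def)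
    qed
  qed
  moreover have "(i, Suc i) \<notin> ?f ` inversions n w"
  proof
    assume "(i, Suc i) \<in> ?f ` inversions n w"
    then obtain a b where ab: "(a, b) \<in> inversions n w" "?s a = i" "?s b = Suc i" by auto
    then have "a = Suc i" "b = i"
      by (metis transpose_apply_first transpose_involutory, metis transpose_apply_second transpose_involutory)
    with ab show False by (simp add: inversions_def)
  qed
  moreover have "inj ?f"
    by (rule injI) (auto dest!: transpose_eq_imp_eq simp: transpose_eq_iff)
  then have "card (?f ` inversions n w) = card (inversions n w)"
    by (intro card_image) (auto intro: inj_on_subset)
  ultimately show ?thesis
    by (simp add: finite_inversions)
qed

lemma card_inversions_descent:
  assumes i: "i \<in> {1..<n}" and desc: "w (Suc i) < w i"
  shows "card (inversions n w) = Suc (card (inversions n (w \<circ> simple_reflection i)))"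
proof -
  have "(w \<circ> simple_reflection i) \<circ> simple_reflection i = w"
    by (simp add: comp_assoc)
  then show ?thesis
    using card_inversions_ascent[OF i, of "w \<circ> simple_reflection i"] desc by simp
qed

lemma ascending_permutation_eq_id:
  assumes w: "w permutes {1..n}" and asc: "\<And>i. i \<in> {1..<n} \<Longrightarrow> w i < w (Suc i)"
  shows "w = id"
proof (rule permutes_natset_ge[OF w])
  have "i \<le> w i" if "1 \<le> i" "i \<le> n" for i
    using that
  proof (induction i rule: dec_induct)
    case base
    then show ?case using permutes_in_image[OF w, of 1] by auto
  next
    case (step i)
    then show ?case using asc[of i] by simp
  qed
  then show "\<forall>i\<in>{1..n}. i \<le> w i" by simp
qed

definition word_product :: "nat list \<Rightarrow> nat \<Rightarrow> nat" where
  "word_product is = foldr (\<lambda>i u. simple_reflection i \<circ> u) is id"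

lemma word_product_Nil [simp]: "word_product [] = id"
  by (simp add: word_product_def)

lemma word_product_snoc [simp]: "word_product (is @ [i]) = word_product is \<circ> simple_reflection i"
  by (induction "is") (simp_all add: word_product_def comp_assoc)

lemma word_product_permutes:
  assumes "set is \<subseteq> {1..<n}"
  shows "word_product is permutes {1..n}"
  using assms
proof (induction "is" rule: rev_induct)
  case (snoc i "is")
  then show ?case
    using permutes_compose_simple_reflection[of "word_product is" n i] by (simp add: comp_def)
qed (simp add: permutes_def)

lemma card_inversions_word_product:
  assumes "set is \<subseteq> {1..<n}"
  shows "card (inversions n (word_product is)) \<le> length is"
  using assms
proof (induction "is" rule: rev_induct)
  case Nil
  then show ?case by simp
next
  case (snoc i "is")
  let ?u = "word_product is"
  have "i \<in> {1..<n}" using snoc.prems by simp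
  moreover have "?u i \<noteq> ?u (Suc i)"
    using injD[OF permutes_inj[OF word_product_permutes[of "is" n]], of i "Suc i"] snoc.prems by auto
  ultimately have "card (inversions n (?u \<circ> simple_reflection i)) \<le> Suc (card (inversions n ?u))"
    using card_inversions_ascent[of i n ?u] card_inversions_descent[of i n ?u]
    by (cases "?u i" "?u (Suc i)" rule: linorder_cases) auto
  with snoc show ?case by (simp add: comp_def)
qed

lemma exists_reduced_word:
  assumes "w permutes {1..n}"
  shows "\<exists>is. length is = card (inversions n w) \<and> set is \<subseteq> {1..<n} \<and> w = word_product is"
  using assms
proof (induction "card (inversions n w)" arbitrary: w rule: less_induct)
  case less
  show ?case
  proof (cases "\<exists>i\<in>{1..<n}. w (Suc i) < w i")
    case True
    then obtain i where i: "i \<in> {1..<n}" "w (Suc i) < w i" by blast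
    let ?u = "w \<circ> simple_reflection i"
    note card = card_inversions_descent[OF i]
    obtain "is" where "is": "length is = card (inversions n ?u)" "set is \<subseteq> {1..<n}" "?u = word_product is"
      using less.hyps[of ?u] card permutes_compose_simple_reflection[OF less.prems i(1)] by auto
    show ?thesis
    proof (intro exI conjI)
      show "length (is @ [i]) = card (inversions n w)"
        using "is"(1) card by simp
      show "set (is @ [i]) \<subseteq> {1..<n}"
        using "is"(2) i(1) by simp
      show "w = word_product (is @ [i])"
        unfolding word_product_snoc "is"(3)[symmetric] by (simp add: comp_assoc)
    qed
  next
    case False
    have "w i \<noteq> w (Suc i)" for i
      using injD[OF permutes_inj[OF less.prems], of i "Suc i"] by auto
    with False have "w = id"
      by (intro ascending_permutation_eq_id[OF less.prems]) (force simp: not_less le_less)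
    then show ?thesis
      by (intro exI[of _ "[]"]) auto
  qed
qed

lemma coxeter_length_eq_card_inversions:
  assumes "w permutes {1..n}"
  shows "coxeter_length n w = card (inversions n w)"
proof -
  have "(LEAST k. \<exists>is. length is = k \<and> set is \<subseteq> {1..<n} \<and> w = word_product is) = card (inversions n w)"
  proof (rule Least_equality)
    show "\<exists>is. length is = card (inversions n w) \<and> set is \<subseteq> {1..<n} \<and> w = word_product is"
      by (rule exists_reduced_word[OF assms])
  next
    fix k assume "\<exists>is. length is = k \<and> set is \<subseteq> {1..<n} \<and> w = word_product is"
    then obtain "is" where "is": "length is = k" "set is \<subseteq> {1..<n}" "w = word_product is"
      by blast
    show "card (inversions n w) \<le> k"
      using card_inversions_word_product[OF "is"(2)] unfolding "is"(1) "is"(3)[symmetric] .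
  qed
  then show ?thesis
    by (simp only: coxeter_length_def word_product_def)
qed

lemma coxeter_length_ascent:
  assumes "w permutes {1..n}" "i \<in> {1..<n}" "w i < w (Suc i)"
  shows "coxeter_length n (w \<circ> simple_reflection i) = Suc (coxeter_length n w)"
  using coxeter_length_eq_card_inversions[OF assms(1)] card_inversions_ascent[OF assms(2), of w] assms(3)
    coxeter_length_eq_card_inversions[OF permutes_compose_simple_reflection[OF assms(1,2)]] by simp

lemma coxeter_length_descent:
  assumes "w permutes {1..n}" "i \<in> {1..<n}" "w (Suc i) < w i"
  shows "coxeter_length n w = Suc (coxeter_length n (w \<circ> simple_reflection i))"
  using coxeter_length_eq_card_inversions[OF assms(1)] card_inversions_descent[OF assms(2), of w] assms(3)
    coxeter_length_eq_card_inversions[OF permutes_compose_simple_reflection[OF assms(1,2)]] by simp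

lemma coxeter_length_inv:
  assumes w: "w permutes {1..n}"
  shows "coxeter_length n (inv w) = coxeter_length n w"
proof -
  have "bij_betw (\<lambda>(a, b). (w b, w a)) (inversions n w) (inversions n (inv w))"
  proof (rule bij_betw_byWitness[where f' = "\<lambda>(a, b). (inv w b, inv w a)"])
    show "(\<lambda>(a, b). (w b, w a)) ` inversions n w \<subseteq> inversions n (inv w)"
      using permutes_in_image[OF w] by (fastforce simp: inversions_def permutes_inverses[OF w])
    show "(\<lambda>(a, b). (inv w b, inv w a)) ` inversions n (inv w) \<subseteq> inversions n w"
      using permutes_in_image[OF permutes_inv[OF w]] by (fastforce simp: inversions_def permutes_inverses[OF w])
  qed (auto simp: permutes_inverses[OF w])
  then show ?thesis
    using w by (simp add: coxeter_length_eq_card_inversions permutes_inv bij_betw_same_card)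
qed

lemma bruhat_less_imp_coxeter_length_less:
  assumes "bruhat_less n u v"
  shows "coxeter_length n u < coxeter_length n v"
  using assms unfolding bruhat_less_def
proof (induction rule: tranclp_induct)
  case (base v)
  then show ?case by (simp add: bruhat_step_def)
next
  case (step v v')
  then have "coxeter_length n v < coxeter_length n v'" by (simp add: bruhat_step_def)
  with step.IH show ?case by simp
qed

text \<open>
  Each step in the Bruhat order increases the length, and right multiplication by a simple reflection
  changes the length by one, up or down according to the order of the two values.
\<close>

lemma bruhat_less_simple_reflection_iff:
  assumes w: "w permutes {1..n}" and i: "i \<in> {1..<n}"
  shows "bruhat_less n w (w \<circ> simple_reflection i) \<longleftrightarrow> w i < w (Suc i)"
proof
  assume "bruhat_less n w (w \<circ> simple_reflection i)"
  then have "coxeter_length n w < coxeter_length n (w \<circ> simple_reflection i)"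
    by (rule bruhat_less_imp_coxeter_length_less)
  then have "\<not> w (Suc i) < w i"
    using coxeter_length_descent[OF w i] by auto
  moreover have "w i \<noteq> w (Suc i)"
    using injD[OF permutes_inj[OF w], of i "Suc i"] by auto
  ultimately show "w i < w (Suc i)" by simp
next
  assume "w i < w (Suc i)"
  then have "bruhat_step n w (w \<circ> simple_reflection i)"
    unfolding bruhat_step_def
  proof (intro conjI bexI)
    show "coxeter_length n w < coxeter_length n (w \<circ> simple_reflection i)"
      using coxeter_length_ascent[OF w i \<open>w i < w (Suc i)\<close>] by simp
  qed (use w i in auto)
  then show "bruhat_less n w (w \<circ> simple_reflection i)"
    unfolding bruhat_less_def by blast
qed

lemma longest_perm_involutory [simp]: "longest_perm n (longest_perm n i) = i"
  by (auto simp: longest_perm_def)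

lemma longest_perm_comp_longest_perm [simp]: "longest_perm n \<circ> longest_perm n = id"
  by (simp add: fun_eq_iff)

lemma longest_perm_permutes: "longest_perm n permutes {1..n}"
  by (rule bij_imp_permutes) (auto simp: longest_perm_def intro!: bij_betw_byWitness[where f' = "longest_perm n"])

lemma longest_perm_less_iff:
  assumes "i \<in> {1..n}" "j \<in> {1..n}"
  shows "longest_perm n i < longest_perm n j \<longleftrightarrow> j < i"
  using assms by (auto simp: longest_perm_def)

section \<open>Exchanging the parameters of two adjacent rows\<close>

text \<open>
  Two vertices on top of each other as they occur in the lattice model, where the bottom spin is
  prescribed and need not be the one forced by conservation.
\<close>

definition vertex_pair ::
  "'a::field \<Rightarrow> 'a \<Rightarrow> 'a \<Rightarrow> 'a \<Rightarrow> nat option \<Rightarrow> nat option \<Rightarrow> nat option \<Rightarrow> nat option \<Rightarrow> nat set \<Rightarrow> nat set \<Rightarrow> 'a"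
where
  "vertex_pair t a b y L1 L2 R1 R2 S S' =
     (if S' = next_spin L2 (next_spin L1 S R1) R2 then two_weights t (a / y) (b / y) L1 L2 R1 R2 S else 0)"

lemma sum_middle_spin:
  assumes "finite C" "S \<subseteq> C" "set_option L1 \<subseteq> C"
  shows "(\<Sum>\<mu>\<in>Pow C. vertex_weight t a y L1 S R1 \<mu> * vertex_weight t b y L2 \<mu> R2 S') =
           vertex_pair t a b y L1 L2 R1 R2 S S'"
proof -
  let ?\<mu> = "next_spin L1 S R1"
  have S: "finite S" using assms finite_subset by blast
  have \<mu>: "?\<mu> \<in> Pow C" using assms by (auto simp: next_spin_def)
  then have "finite ?\<mu>" using assms finite_subset by blast
  have "(\<Sum>\<mu>\<in>Pow C. vertex_weight t a y L1 S R1 \<mu> * vertex_weight t b y L2 \<mu> R2 S') =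
      (\<Sum>\<mu>\<in>Pow C. if \<mu> = ?\<mu> then local_weight t (a / y) L1 S R1 * vertex_weight t b y L2 ?\<mu> R2 S' else 0)"
    by (intro sum.cong refl) (simp add: vertex_weight_eq_local_weight[OF S])
  also have "\<dots> = local_weight t (a / y) L1 S R1 * vertex_weight t b y L2 ?\<mu> R2 S'"
    using \<mu> assms(1) by simp
  finally show ?thesis
    by (simp add: vertex_pair_def two_weights_def vertex_weight_eq_local_weight[OF \<open>finite ?\<mu>\<close>])
qed

definition conserved_pair ::
  "nat option \<Rightarrow> nat option \<Rightarrow> nat option \<Rightarrow> nat option \<Rightarrow> nat set \<Rightarrow> nat set \<Rightarrow> bool" where
  "conserved_pair L1 L2 R1 R2 S S' \<longleftrightarrow>
     (\<forall>e. of_bool (L1 = Some e) + of_bool (L2 = Some e) + of_bool (e \<in> S) =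
          of_bool (R1 = Some e) + of_bool (R2 = Some e) + (of_bool (e \<in> S') :: nat))"

lemma conserved_pair_commute:
  "conserved_pair L2 L1 R1 R2 S S' \<longleftrightarrow> conserved_pair L1 L2 R1 R2 S S'"
  "conserved_pair L1 L2 R2 R1 S S' \<longleftrightarrow> conserved_pair L1 L2 R1 R2 S S'"
  unfolding conserved_pair_def by (simp_all only: add.commute)

text \<open>
  In this form the condition on the bottom spin is visibly symmetric in the two left and in the two
  right spins, so it is the same for all terms of the Yang--Baxter equation.
\<close>

lemma vertex_pair_conservation:
  "vertex_pair t a b y L1 L2 R1 R2 S S' =
     (if conserved_pair L1 L2 R1 R2 S S' then two_weights t (a / y) (b / y) L1 L2 R1 R2 S else 0)"
proof (cases "two_weights t (a / y) (b / y) L1 L2 R1 R2 S = 0")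
  case False
  let ?T = "next_spin L2 (next_spin L1 S R1) R2"
  have "of_bool (L1 = Some e) + of_bool (L2 = Some e) + of_bool (e \<in> S) =
      of_bool (R1 = Some e) + of_bool (R2 = Some e) + (of_bool (e \<in> ?T) :: nat)" for e
  proof -
    have "core_weight t (a / y) L1 S R1 \<noteq> 0" "core_weight t (b / y) L2 (next_spin L1 S R1) R2 \<noteq> 0"
      using False by (auto simp: two_weights_def local_weight_def)
    from core_weight_conserves[OF this(1), of e] core_weight_conserves[OF this(2), of e]
    show ?thesis by linarith
  qed
  then have "conserved_pair L1 L2 R1 R2 S S' \<longleftrightarrow> (\<forall>e. e \<in> ?T \<longleftrightarrow> e \<in> S')"
    by (simp add: conserved_pair_def) blast
  then have "conserved_pair L1 L2 R1 R2 S S' \<longleftrightarrow> S' = ?T"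
    by (simp only: set_eq_iff) blast
  then show ?thesis by (simp only: vertex_pair_def)
qed (simp add: vertex_pair_def)

lemma vertex_exchange:
  assumes "finite S"
  shows "R_diag t a b L1 L2 * vertex_pair t b a y L1 L2 R1 R2 S S' +
         R_swap t a b L1 L2 * vertex_pair t b a y L2 L1 R1 R2 S S' =
         vertex_pair t a b y L1 L2 R1 R2 S S' * R_diag t a b R1 R2 +
         vertex_pair t a b y L1 L2 R2 R1 S S' * R_swap t a b R2 R1"
  using yang_baxter_equation[OF assms, of t a b "inverse y" L1 L2 R1 R2]
  by (simp add: vertex_pair_conservation conserved_pair_commute yang_baxter_def divide_inverse)

text \<open>
  Two adjacent rows, cut off after column \<open>k\<close>, summed over the vertical spins between them.
\<close>

definition row_pair ::
  "nat \<Rightarrow> 'a::field \<Rightarrow> (nat \<Rightarrow> 'a) \<Rightarrow> 'a \<Rightarrow> 'a \<Rightarrow> nat option \<Rightarrow> nat option \<Rightarrow>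
   (nat \<Rightarrow> nat set) \<Rightarrow> (nat \<Rightarrow> nat set) \<Rightarrow> nat \<Rightarrow> nat option \<Rightarrow> nat option \<Rightarrow> 'a"
where
  "row_pair n t y a b R1 R2 S S' k L1 L2 =
     (\<Sum>M\<in>{1..k} \<rightarrow>\<^sub>E Pow {1..n}. row n t y a R1 S M k L1 * row n t y b R2 M S' k L2)"

lemma row_pair_Suc:
  assumes "S (Suc k) \<subseteq> {1..n}" "L1 \<in> horizontal_spins n"
  shows "row_pair n t y a b R1 R2 S S' (Suc k) L1 L2 =
    (\<Sum>A\<in>horizontal_spins n. \<Sum>B\<in>horizontal_spins n.
       vertex_pair t a b (y (Suc k)) L1 L2 A B (S (Suc k)) (S' (Suc k)) * row_pair n t y a b R1 R2 S S' k A B)"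
proof -
  let ?H = "horizontal_spins n" and ?y = "y (Suc k)"
  let ?P = "{1..k} \<rightarrow>\<^sub>E Pow {1..n}"
  let ?u = "\<lambda>\<mu> A. vertex_weight t a ?y L1 (S (Suc k)) A \<mu>"
  let ?v = "\<lambda>\<mu> B. vertex_weight t b ?y L2 \<mu> B (S' (Suc k))"
  let ?f = "\<lambda>M A. row n t y a R1 S M k A" and ?g = "\<lambda>M B. row n t y b R2 M S' k B"
  have split: "{1..Suc k} = insert (Suc k) {1..k}" by auto
  have f: "row n t y a R1 S (M(Suc k := \<mu>)) (Suc k) L1 = (\<Sum>A\<in>?H. ?f M A * ?u \<mu> A)" for M \<mu>
    unfolding row_def chain.simps
    by (intro sum.cong refl arg_cong2[where f = times] chain_cong) auto
  have g: "row n t y b R2 (M(Suc k := \<mu>)) S' (Suc k) L2 = (\<Sum>B\<in>?H. ?g M B * ?v \<mu> B)" for M \<mu>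
    unfolding row_def chain.simps
    by (intro sum.cong refl arg_cong2[where f = times] chain_cong) auto
  have "row_pair n t y a b R1 R2 S S' (Suc k) L1 L2 =
      (\<Sum>\<mu>\<in>Pow {1..n}. \<Sum>M\<in>?P. (\<Sum>A\<in>?H. ?f M A * ?u \<mu> A) * (\<Sum>B\<in>?H. ?g M B * ?v \<mu> B))"
    unfolding row_pair_def split by (subst sum_PiE_insert) (simp_all add: f g)
  also have "\<dots> = (\<Sum>\<mu>\<in>Pow {1..n}. \<Sum>M\<in>?P. \<Sum>A\<in>?H. \<Sum>B\<in>?H. (?u \<mu> A * ?v \<mu> B) * (?f M A * ?g M B))"
    by (simp add: sum_product mult_ac)
  also have "\<dots> = (\<Sum>\<mu>\<in>Pow {1..n}. \<Sum>A\<in>?H. \<Sum>B\<in>?H. \<Sum>M\<in>?P. (?u \<mu> A * ?v \<mu> B) * (?f M A * ?g M B))"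
    by (intro sum.cong refl, subst sum.swap, intro sum.cong refl, rule sum.swap)
  also have "\<dots> = (\<Sum>A\<in>?H. \<Sum>B\<in>?H. \<Sum>\<mu>\<in>Pow {1..n}. \<Sum>M\<in>?P. (?u \<mu> A * ?v \<mu> B) * (?f M A * ?g M B))"
    by (subst sum.swap, intro sum.cong refl, rule sum.swap)
  also have "\<dots> = (\<Sum>A\<in>?H. \<Sum>B\<in>?H. (\<Sum>\<mu>\<in>Pow {1..n}. ?u \<mu> A * ?v \<mu> B) * row_pair n t y a b R1 R2 S S' k A B)"
    unfolding row_pair_def by (simp add: sum_product)
  also have "\<dots> = (\<Sum>A\<in>?H. \<Sum>B\<in>?H.
       vertex_pair t a b ?y L1 L2 A B (S (Suc k)) (S' (Suc k)) * row_pair n t y a b R1 R2 S S' k A B)"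
    using assms by (subst sum_middle_spin) (auto simp: horizontal_spins_def)
  finally show ?thesis .
qed

text \<open>
  The train argument, by induction over the columns: the \<open>R\<close>-matrix passes through the leftmost column
  by the Yang--Baxter equation and through the others by induction. The swapped term needs an
  exchange of the two summation indices.
\<close>

lemma row_exchange:
  assumes "\<And>j. j \<in> {1..k} \<Longrightarrow> S j \<subseteq> {1..n}" "L1 \<in> horizontal_spins n" "L2 \<in> horizontal_spins n"
  shows "R_diag t a b L1 L2 * row_pair n t y b a R1 R2 S S' k L1 L2 +
         R_swap t a b L1 L2 * row_pair n t y b a R1 R2 S S' k L2 L1 =
         row_pair n t y a b R1 R2 S S' k L1 L2 * R_diag t a b R1 R2 +
         row_pair n t y a b R2 R1 S S' k L1 L2 * R_swap t a b R2 R1"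
  using assms
proof (induction k arbitrary: L1 L2)
  case 0
  show ?case
    by (simp add: row_pair_def row_def)
next
  case (Suc k)
  let ?H = "horizontal_spins n"
  let ?V = "\<lambda>a b L1 L2 A B. vertex_pair t a b (y (Suc k)) L1 L2 A B (S (Suc k)) (S' (Suc k))"
  let ?X = "\<lambda>A B. row_pair n t y b a R1 R2 S S' k A B"
  let ?Y = "\<lambda>R1 R2 A B. row_pair n t y a b R1 R2 S S' k A B"
  have fin: "finite (S (Suc k))" using Suc.prems(1)[of "Suc k"] finite_subset by auto
  have "R_diag t a b L1 L2 * row_pair n t y b a R1 R2 S S' (Suc k) L1 L2 +
         R_swap t a b L1 L2 * row_pair n t y b a R1 R2 S S' (Suc k) L2 L1 =
    (\<Sum>A\<in>?H. \<Sum>B\<in>?H. (R_diag t a b L1 L2 * ?V b a L1 L2 A B + R_swap t a b L1 L2 * ?V b a L2 L1 A B) * ?X A B)"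
    using Suc.prems by (simp add: row_pair_Suc sum_distrib_left sum.distrib algebra_simps)
  also have "\<dots> = (\<Sum>A\<in>?H. \<Sum>B\<in>?H. ?V a b L1 L2 A B * R_diag t a b A B * ?X A B) +
     (\<Sum>A\<in>?H. \<Sum>B\<in>?H. ?V a b L1 L2 B A * R_swap t a b B A * ?X A B)"
    unfolding vertex_exchange[OF fin] by (simp add: sum.distrib distrib_right)
  also have "(\<Sum>A\<in>?H. \<Sum>B\<in>?H. ?V a b L1 L2 B A * R_swap t a b B A * ?X A B) =
     (\<Sum>A\<in>?H. \<Sum>B\<in>?H. ?V a b L1 L2 A B * R_swap t a b A B * ?X B A)"
    by (rule sum.swap)
  also have "(\<Sum>A\<in>?H. \<Sum>B\<in>?H. ?V a b L1 L2 A B * R_diag t a b A B * ?X A B) + \<dots> =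
     (\<Sum>A\<in>?H. \<Sum>B\<in>?H. ?V a b L1 L2 A B * (R_diag t a b A B * ?X A B + R_swap t a b A B * ?X B A))"
    by (simp add: sum.distrib distrib_left mult.assoc)
  also have "\<dots> = (\<Sum>A\<in>?H. \<Sum>B\<in>?H. ?V a b L1 L2 A B * (?Y R1 R2 A B * R_diag t a b R1 R2 + ?Y R2 R1 A B * R_swap t a b R2 R1))"
    using Suc.prems by (intro sum.cong refl arg_cong2[where f = times] Suc.IH) auto
  also have "\<dots> = row_pair n t y a b R1 R2 S S' (Suc k) L1 L2 * R_diag t a b R1 R2 +
         row_pair n t y a b R2 R1 S S' (Suc k) L1 L2 * R_swap t a b R2 R1"
    using Suc.prems by (simp add: row_pair_Suc sum_distrib_right sum.distrib distrib_left mult.assoc)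
  finally show ?case .
qed

lemma grid_Suc:
  "grid n t \<sigma> w x y (Suc k) S' = (\<Sum>S\<in>{1..n} \<rightarrow>\<^sub>E Pow {1..n}.
     grid n t \<sigma> w x y k S * row n t y (x (Suc k)) (Some (w (Suc k))) S S' n None)"
  by (simp add: grid_def)

lemma grid_cong:
  assumes "\<And>i. i \<in> {1..k} \<Longrightarrow> x i = x' i" "\<And>i. i \<in> {1..k} \<Longrightarrow> w i = w' i"
  shows "grid n t \<sigma> w x y k S = grid n t \<sigma> w' x' y k S"
  unfolding grid_def using assms by (intro chain_cong) simp

lemma grid_Suc_Suc:
  "grid n t \<sigma> w x y (Suc (Suc k)) S' = (\<Sum>S\<in>{1..n} \<rightarrow>\<^sub>E Pow {1..n}. grid n t \<sigma> w x y k S *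
     row_pair n t y (x (Suc k)) (x (Suc (Suc k))) (Some (w (Suc k))) (Some (w (Suc (Suc k)))) S S' n None None)"
  unfolding grid_Suc[of n t \<sigma> w x y "Suc k"] grid_Suc[of n t \<sigma> w x y k] row_pair_def
    sum_distrib_left sum_distrib_right
  by (subst sum.swap) (simp add: mult.assoc)

text \<open>
  With uncolored left ends the \<open>R\<close>-matrix reduces to \<open>x i - t * x (i + 1)\<close>, and with right ends
  \<open>w (i + 1) < w i\<close> to the two coefficients on the right-hand side. Rows above \<open>i\<close> are the same in all
  three terms, and the relation is linear in the state below row \<open>i + 1\<close>, so it persists when further
  rows are added.
\<close>

lemma grid_exchange:
  fixes t :: "'a::field"
  assumes i: "1 \<le> i" and k: "Suc i \<le> k" and desc: "w (Suc i) < w i"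
  shows "(x i - t * x (Suc i)) * grid n t \<sigma> w (x \<circ> simple_reflection i) y k S' =
           (1 - t) * x (Suc i) * grid n t \<sigma> w x y k S' +
           (x (Suc i) - x i) * grid n t \<sigma> (w \<circ> simple_reflection i) x y k S'"
  using k
proof (induction k arbitrary: S' rule: dec_induct)
  case base
  obtain m where m: "i = Suc m" using i by (cases i) auto
  let ?Q = "{1..n} \<rightarrow>\<^sub>E Pow {1..n}" and ?a = "x i" and ?b = "x (Suc i)"
  let ?g = "grid n t \<sigma> w x y m"
  let ?row = "\<lambda>a b c d S. row_pair n t y a b (Some c) (Some d) S S' n None None"
  \<comment> \<open>With \<open>None\<close> at both left ends the swap coefficient is zero.\<close>
  have ex: "(?a - t * ?b) * ?row ?b ?a (w i) (w (Suc i)) S =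
      (1 - t) * ?b * ?row ?a ?b (w i) (w (Suc i)) S + (?b - ?a) * ?row ?a ?b (w (Suc i)) (w i) S"
    if "S \<in> ?Q" for S
    using row_exchange[of n S n None None t ?a ?b y "Some (w i)" "Some (w (Suc i))" S'] that desc
    by (auto simp: R_diag_def R_swap_def horizontal_spins_def PiE_iff mult.commute)
  have 1: "grid n t \<sigma> w (x \<circ> simple_reflection i) y (Suc i) S' = (\<Sum>S\<in>?Q. ?g S * ?row ?b ?a (w i) (w (Suc i)) S)"
    unfolding m grid_Suc_Suc by (intro sum.cong refl arg_cong2[where f = times] grid_cong) auto
  have 2: "grid n t \<sigma> w x y (Suc i) S' = (\<Sum>S\<in>?Q. ?g S * ?row ?a ?b (w i) (w (Suc i)) S)"
    unfolding m grid_Suc_Suc ..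
  have 3: "grid n t \<sigma> (w \<circ> simple_reflection i) x y (Suc i) S' = (\<Sum>S\<in>?Q. ?g S * ?row ?a ?b (w (Suc i)) (w i) S)"
    unfolding m grid_Suc_Suc by (intro sum.cong refl arg_cong2[where f = times] grid_cong) auto
  have "(?a - t * ?b) * (\<Sum>S\<in>?Q. ?g S * ?row ?b ?a (w i) (w (Suc i)) S) =
      (\<Sum>S\<in>?Q. ?g S * ((?a - t * ?b) * ?row ?b ?a (w i) (w (Suc i)) S))"
    by (simp add: sum_distrib_left mult_ac)
  also have "\<dots> = (\<Sum>S\<in>?Q. ?g S * ((1 - t) * ?b * ?row ?a ?b (w i) (w (Suc i)) S + (?b - ?a) * ?row ?a ?b (w (Suc i)) (w i) S))"
    by (intro sum.cong refl arg_cong2[where f = times] ex)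
  also have "\<dots> = (1 - t) * ?b * (\<Sum>S\<in>?Q. ?g S * ?row ?a ?b (w i) (w (Suc i)) S) +
      (?b - ?a) * (\<Sum>S\<in>?Q. ?g S * ?row ?a ?b (w (Suc i)) (w i) S)"
    by (simp only: distrib_left sum.distrib sum_distrib_left mult_ac)
  finally show ?case unfolding 1 2 3 .
next
  case (step k)
  let ?Q = "{1..n} \<rightarrow>\<^sub>E Pow {1..n}"
  let ?r = "\<lambda>S. row n t y (x (Suc k)) (Some (w (Suc k))) S S' n None"
  have "simple_reflection i (Suc k) = Suc k" using step by (auto simp: transpose_def)
  then have "(x i - t * x (Suc i)) * grid n t \<sigma> w (x \<circ> simple_reflection i) y (Suc k) S' =
      (\<Sum>S\<in>?Q. ((x i - t * x (Suc i)) * grid n t \<sigma> w (x \<circ> simple_reflection i) y k S) * ?r S)"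
    "(1 - t) * x (Suc i) * grid n t \<sigma> w x y (Suc k) S' = (\<Sum>S\<in>?Q. ((1 - t) * x (Suc i) * grid n t \<sigma> w x y k S) * ?r S)"
    "(x (Suc i) - x i) * grid n t \<sigma> (w \<circ> simple_reflection i) x y (Suc k) S' =
      (\<Sum>S\<in>?Q. ((x (Suc i) - x i) * grid n t \<sigma> (w \<circ> simple_reflection i) x y k S) * ?r S)"
    by (simp_all add: grid_Suc sum_distrib_left mult.assoc)
  then show ?case
    unfolding step.IH by (simp only: distrib_right sum.distrib)
qed

section \<open>The right boundary given by the longest element\<close>

text \<open>
  Seen from the right end, the color \<open>c\<close> cannot disappear before column \<open>c\<close>: if its horizontal line
  began at an earlier column, it would have to be on the top edge there, and if another color changed
  into \<open>c\<close> the same would be required.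
\<close>

lemma row_before_turn:
  assumes c: "c \<in> {1..n}" and "k < c" "\<And>j. j \<in> {1..k} \<Longrightarrow> S j = {j}"
  shows "row n t y x (Some c) S S' k L =
    (if L = Some c \<and> (\<forall>j\<in>{1..k}. S' j = {j}) then \<Prod>j\<in>{1..k}. 1 - x / y j else 0)"
  using assms(2,3)
proof (induction k arbitrary: L)
  case 0
  then show ?case by (simp add: row_def)
next
  case (Suc k)
  let ?P = "\<forall>j\<in>{1..k}. S' j = {j}" and ?A = "\<Prod>j\<in>{1..k}. 1 - x / y j"
  let ?v = "vertex_weight t x (y (Suc k)) L {Suc k} (Some c) (S' (Suc k))"
  have H: "Some c \<in> horizontal_spins n" "finite (horizontal_spins n)"
    using c by (auto simp: horizontal_spins_def)
  have IH: "row n t y x (Some c) S S' k R = (if R = Some c \<and> ?P then ?A else 0)" for R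
    using Suc.prems by (intro Suc.IH) auto
  have "row n t y x (Some c) S S' (Suc k) L =
      (\<Sum>R\<in>horizontal_spins n. row n t y x (Some c) S S' k R * vertex_weight t x (y (Suc k)) L {Suc k} R (S' (Suc k)))"
    using Suc.prems(2)[of "Suc k"] by (simp add: row_def)
  also have "\<dots> = (\<Sum>R\<in>horizontal_spins n. if R = Some c then (if ?P then ?A * ?v else 0) else 0)"
    unfolding IH by (intro sum.cong refl) simp
  also have "\<dots> = (if ?P then ?A * ?v else 0)"
    using H by simp
  also have "?v = (if L = Some c \<and> S' (Suc k) = {Suc k} then 1 - x / y (Suc k) else 0)"
  proof -
    have no: "{e. e = Suc k \<and> c < e} = {}" using Suc.prems(1) by auto
    have "c \<noteq> Suc k" using Suc.prems(1) by simp
    then show ?thesis by (cases L) (simp_all add: no del: Collect_empty_eq)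
  qed
  finally show ?case
    by (simp add: atLeastAtMostSuc_conv conj_commute mult.commute)
qed

text \<open>
  Since the left end is uncolored and the columns to the left of \<open>c\<close> are empty, nothing enters
  column \<open>c\<close> from the left, so \<open>c\<close> turns right there.
\<close>

lemma row_after_turn:
  assumes c: "c \<in> {1..n}" and "c \<le> k"
    and S: "\<And>j. j \<in> {1..k} \<Longrightarrow> S j = (if j \<le> c then {j} else {})"
  shows "row n t y x (Some c) S S' k None =
    (if \<forall>j\<in>{1..k}. S' j = (if j < c then {j} else {}) then \<Prod>j\<in>{1..<c}. 1 - x / y j else 0)"
  using assms(2,3)
proof (induction k rule: dec_induct)
  case base
  obtain m where m: "c = Suc m" using c by (cases c) auto
  let ?P = "\<forall>j\<in>{1..m}. S' j = {j}" and ?A = "\<Prod>j\<in>{1..m}. 1 - x / y j"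
  let ?v = "vertex_weight t x (y c) None {c} (Some c) (S' c)"
  have H: "Some c \<in> horizontal_spins n" "finite (horizontal_spins n)"
    using c by (auto simp: horizontal_spins_def)
  have before: "row n t y x (Some c) S S' m R = (if R = Some c \<and> ?P then ?A else 0)" for R
    using base m c by (intro row_before_turn) auto
  have "row n t y x (Some c) S S' c None =
      (\<Sum>R\<in>horizontal_spins n. row n t y x (Some c) S S' m R * vertex_weight t x (y c) None {c} R (S' c))"
    using base[of c] m by (simp add: row_def)
  also have "\<dots> = (\<Sum>R\<in>horizontal_spins n. if R = Some c then (if ?P then ?A * ?v else 0) else 0)"
    unfolding before by (intro sum.cong refl) simp
  also have "\<dots> = (if ?P then ?A * ?v else 0)"
    using H by simp
  also have "?v = (if S' c = {} then 1 else 0)"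
  proof -
    have no: "{e. e = c \<and> e < c} = {}" "{e. e = c \<and> c < e} = {}" by auto
    show ?thesis by (simp add: no)
  qed
  finally show ?case
    by (auto simp: m atLeastAtMostSuc_conv atLeastLessThanSuc_atLeastAtMost less_Suc_eq_le)
next
  case (step k)
  let ?P = "\<forall>j\<in>{1..k}. S' j = (if j < c then {j} else {})" and ?A = "\<Prod>j\<in>{1..<c}. 1 - x / y j"
  have H: "None \<in> horizontal_spins n" "finite (horizontal_spins n)"
    by (auto simp: horizontal_spins_def)
  have IH: "row n t y x (Some c) S S' k None = (if ?P then ?A else 0)"
    using step.prems by (intro step.IH) auto
  have "row n t y x (Some c) S S' (Suc k) None =
      (\<Sum>R\<in>horizontal_spins n. row n t y x (Some c) S S' k R * vertex_weight t x (y (Suc k)) None {} R (S' (Suc k)))"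
    using step.prems[of "Suc k"] step.hyps by (simp add: row_def)
  also have "\<dots> = (\<Sum>R\<in>horizontal_spins n. if R = None then (if ?P \<and> S' (Suc k) = {} then ?A else 0) else 0)"
  proof (intro sum.cong refl)
    fix R
    show "row n t y x (Some c) S S' k R * vertex_weight t x (y (Suc k)) None {} R (S' (Suc k)) =
        (if R = None then (if ?P \<and> S' (Suc k) = {} then ?A else 0) else 0)"
      by (cases R) (simp_all add: IH)
  qed
  also have "\<dots> = (if ?P \<and> S' (Suc k) = {} then ?A else 0)"
    using H by simp
  finally show ?case
    using step.hyps by (simp add: atLeastAtMostSuc_conv conj_commute)
qed

lemma grid_longest_perm:
  assumes "k \<le> n" "S' \<in> {1..n} \<rightarrow>\<^sub>E Pow {1..n}"
  shows "grid n t id (longest_perm n) x y k S' =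
    (if S' = (\<lambda>j\<in>{1..n}. if j \<le> n - k then {j} else {})
     then \<Prod>i\<in>{1..k}. \<Prod>j\<in>{1..n - i}. 1 - x i / y j else 0)"
  using assms
proof (induction k arbitrary: S')
  case 0
  have eq: "(\<lambda>j\<in>{1..n}. {id j}) = (\<lambda>j\<in>{1..n}. if j \<le> n - 0 then {j} else {})"
    by (intro restrict_ext) simp
  show ?case
    unfolding grid_def chain.simps eq by (simp only: of_bool_def eq_commute[of S']) simp
next
  case (Suc k)
  let ?Q = "{1..n} \<rightarrow>\<^sub>E Pow {1..n}" and ?c = "n - k"
  let ?U = "\<lambda>k. \<lambda>j\<in>{1..n}. if j \<le> n - k then {j} else {}"
  let ?A = "\<lambda>k. \<Prod>i\<in>{1..k}. \<Prod>j\<in>{1..n - i}. 1 - x i / y j"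
  have c: "?c \<in> {1..n}" "longest_perm n (Suc k) = ?c"
    using Suc.prems by (auto simp: longest_perm_def)
  have Q: "finite ?Q" "?U k \<in> ?Q"
    by (auto intro!: finite_PiE)
  have "grid n t id (longest_perm n) x y (Suc k) S' =
      (\<Sum>S\<in>?Q. if S = ?U k then ?A k * row n t y (x (Suc k)) (Some ?c) (?U k) S' n None else 0)"
    unfolding grid_Suc c(2)
  proof (intro sum.cong refl)
    fix S assume "S \<in> ?Q"
    then have "grid n t id (longest_perm n) x y k S = (if S = ?U k then ?A k else 0)"
      using Suc.prems by (intro Suc.IH) auto
    then show "grid n t id (longest_perm n) x y k S * row n t y (x (Suc k)) (Some ?c) S S' n None =
        (if S = ?U k then ?A k * row n t y (x (Suc k)) (Some ?c) (?U k) S' n None else 0)"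
      by simp
  qed
  also have "\<dots> = ?A k * row n t y (x (Suc k)) (Some ?c) (?U k) S' n None"
    using Q by simp
  also have "row n t y (x (Suc k)) (Some ?c) (?U k) S' n None =
      (if \<forall>j\<in>{1..n}. S' j = (if j < ?c then {j} else {}) then \<Prod>j\<in>{1..<?c}. 1 - x (Suc k) / y j else 0)"
    using c by (intro row_after_turn) auto
  also have "(\<forall>j\<in>{1..n}. S' j = (if j < ?c then {j} else {})) \<longleftrightarrow> S' = ?U (Suc k)"
  proof -
    have "(\<forall>j\<in>{1..n}. S' j = ?U (Suc k) j) \<longleftrightarrow> S' = ?U (Suc k)"
    proof
      assume eq: "\<forall>j\<in>{1..n}. S' j = ?U (Suc k) j"
      show "S' = ?U (Suc k)"
      proof (rule PiE_ext)
        show "S' \<in> ?Q" by (rule Suc.prems(2))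
        show "?U (Suc k) \<in> ?Q" by auto
      qed (use eq in blast)
    qed blast
    moreover have "j < ?c \<longleftrightarrow> j \<le> n - Suc k" for j using Suc.prems(1) by auto
    ultimately show ?thesis by simp
  qed
  also have "{1..<?c} = {1..n - Suc k}" using Suc.prems(1) by auto
  finally show ?case by simp
qed

section \<open>The recursion of the motivic Chern classes\<close>

lemma partition_function_longest_perm:
  "partition_function n t id (longest_perm n) x y =
     (\<Prod>(i, j) \<in> {(i, j). 1 \<le> i \<and> 1 \<le> j \<and> i + j \<le> n}. 1 - x i / y j)"
proof (cases n)
  case 0
  then have empty: "{(i, j). 1 \<le> i \<and> 1 \<le> j \<and> i + j \<le> n} = {}" by auto
  show ?thesis unfolding empty by (simp add: partition_function_def 0)
next
  case (Suc m)
  have "partition_function n t id (longest_perm n) x y = (\<Prod>i\<in>{1..n}. \<Prod>j\<in>{1..n - i}. 1 - x i / y j)"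
    unfolding partition_function_eq_grid[OF Suc longest_perm_permutes permutes_id]
    by (subst grid_longest_perm) (auto intro!: restrict_ext)
  also have "\<dots> = (\<Prod>(i, j)\<in>Sigma {1..n} (\<lambda>i. {1..n - i}). 1 - x i / y j)"
    by (rule prod.Sigma) auto
  also have "Sigma {1..n} (\<lambda>i. {1..n - i}) = {(i, j). 1 \<le> i \<and> 1 \<le> j \<and> i + j \<le> n}"
    by auto
  finally show ?thesis .
qed

lemma partition_function_exchange:
  fixes t :: "'a::field"
  assumes w: "w permutes {1..n}" and i: "i \<in> {1..<n}" and desc: "w (Suc i) < w i"
  shows "(x i - t * x (Suc i)) * partition_function n t id w (x \<circ> simple_reflection i) y =
           (1 - t) * x (Suc i) * partition_function n t id w x y +
           (x (Suc i) - x i) * partition_function n t id (w \<circ> simple_reflection i) x y"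
proof -
  obtain m where m: "n = Suc m" using i by (cases n) auto
  note grid = partition_function_eq_grid[OF m _ permutes_id]
  show ?thesis
    unfolding grid[OF w] grid[OF permutes_compose_simple_reflection[OF w i]]
    using i desc by (intro grid_exchange) auto
qed

lemma generic_point_simple_reflection:
  assumes "generic_point n x y" "i \<in> {1..<n}"
  shows "generic_point n (x \<circ> simple_reflection i) y"
proof -
  have s: "simple_reflection i permutes {1..n}"
    using assms(2) by (intro permutes_swap_id) auto
  then have "inj_on (x \<circ> simple_reflection i) {1..n}"
    using assms(1) by (intro comp_inj_on) (auto simp: generic_point_def permutes_inj_on permutes_image)
  moreover have "(x \<circ> simple_reflection i) j \<noteq> 0" if "j \<in> {1..n}" for j
    using assms(1) permutes_in_image[OF s, of j] that by (auto simp: generic_point_def)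
  ultimately show ?thesis
    using assms(1) by (auto simp: generic_point_def)
qed

lemma generic_point_longest_perm:
  assumes "generic_point n x y"
  shows "generic_point n x (y \<circ> longest_perm n)"
  using assms permutes_in_image[OF longest_perm_permutes[of n]] by (auto simp: generic_point_def)

text \<open>
  The exchange relation solved for the partition function of \<open>w s\<^sub>i\<close>, which requires
  \<open>x i \<noteq> x (i + 1)\<close>.
\<close>

lemma partition_function_T_dual:
  fixes t :: "'a::field"
  assumes w: "w permutes {1..n}" and i: "i \<in> {1..<n}" and desc: "w (Suc i) < w i"
    and t: "t \<noteq> 0" and gen: "generic_point n x y'"
  shows "partition_function n t id (w \<circ> simple_reflection i) x y =
           - t * T_dual t i (partition_function n t id w) x y"
proof -
  define a b f g h where "a = x i" and "b = x (Suc i)"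
    and "f = partition_function n t id w x y"
    and "g = partition_function n t id w (x \<circ> simple_reflection i) y"
    and "h = partition_function n t id (w \<circ> simple_reflection i) x y"
  have ab: "a \<noteq> 0" "b \<noteq> 0" using gen i by (auto simp: generic_point_def a_def b_def)
  have "x i \<noteq> x (Suc i)"
    using gen i inj_onD[of x "{1..n}" i "Suc i"] by (auto simp: generic_point_def)
  then have ne: "a \<noteq> b" by (simp add: a_def b_def)
  have *: "(a - t * b) * g = (1 - t) * b * f + (b - a) * h"
    using partition_function_exchange[OF w i desc, of x t y] by (simp add: a_def b_def f_def g_def h_def)
  have 1: "- t * ((1 - inverse t) / (a / b - 1)) = (1 - t) * b / (a - b)"
    using ab ne t by (simp add: field_simps)
  have 2: "- t * ((- inverse t + b / a) / (b / a - 1)) = - (a - t * b) / (a - b)"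
    using ab ne t by (simp add: field_simps)
  have "- t * T_dual t i (partition_function n t id w) x y =
      (- t * ((1 - inverse t) / (a / b - 1))) * f + (- t * ((- inverse t + b / a) / (b / a - 1))) * g"
    by (simp add: T_dual_def a_def b_def f_def g_def algebra_simps)
  also have "\<dots> = ((1 - t) * b * f - (a - t * b) * g) / (a - b)"
    unfolding 1 2
    by (simp only: times_divide_eq_left add_divide_distrib[symmetric] mult_minus_left add_uminus_conv_diff)
  also have "\<dots> = h"
    unfolding * using ne by (simp add: field_simps)
  finally show ?thesis by (simp add: h_def)
qed

text \<open>
  Every permutation other than the identity has a descent, so the recursion computes its value from
  values at a shorter permutation; the points at which these are needed are again generic.
\<close>

lemma is_MC_dual_X_unique:
  assumes M: "is_MC_dual_X n t M" and N: "is_MC_dual_X n t N"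
  shows "M = N"
proof -
  have *: "M w x y = N w x y" if "w permutes {1..n}" "generic_point n x y" for w x y
    using that
  proof (induction "coxeter_length n w" arbitrary: w x rule: less_induct)
    case less
    note w = less.prems(1) and gen = less.prems(2)
    show ?case
    proof (cases "\<exists>i\<in>{1..<n}. w (Suc i) < w i")
      case True
      then obtain i where i: "i \<in> {1..<n}" and desc: "w (Suc i) < w i" by blast
      define u where "u = w \<circ> simple_reflection i"
      have u: "u permutes {1..n}" and wu: "w = u \<circ> simple_reflection i" and asc: "u i < u (Suc i)"
        using permutes_compose_simple_reflection[OF w i] desc by (simp_all add: u_def comp_assoc)
      have len: "coxeter_length n u < coxeter_length n w"
        using coxeter_length_descent[OF w i desc] by (simp add: u_def)
      have less_uw: "bruhat_less n u (u \<circ> simple_reflection i)"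
        using bruhat_less_simple_reflection_iff[OF u i] asc by simp
      have "M w x y = T_dual t i (M u) x y" "N w x y = T_dual t i (N u) x y"
        using M N u i less_uw gen unfolding is_MC_dual_X_def wu by blast+
      moreover have "M u x y = N u x y"
          "M u (x \<circ> simple_reflection i) y = N u (x \<circ> simple_reflection i) y"
        using less.hyps[OF len u] gen generic_point_simple_reflection[OF gen i] by blast+
      ultimately show ?thesis by (simp add: T_dual_def)
    next
      case False
      have "w i \<noteq> w (Suc i)" for i
        using injD[OF permutes_inj[OF w], of i "Suc i"] by auto
      with False have "w = id"
        by (intro ascending_permutation_eq_id[OF w]) (force simp: not_less le_less)
      then show ?thesis
        using M N gen by (simp add: is_MC_dual_X_def)
    qed
  qed
  show ?thesis
  proof (intro ext)
    fix w x y
    show "M w x y = N w x y"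
    proof (cases "w permutes {1..n} \<and> generic_point n x y")
      case False
      then have "M w x y = 0" "N w x y = 0"
        using M N unfolding is_MC_dual_X_def by blast+
      then show ?thesis by simp
    qed (use * in blast)
  qed
qed

text \<open>
  Reversing \<open>y\<close> turns the staircase \<open>i + j \<le> n\<close> into the triangle \<open>i < j\<close>.
\<close>

lemma staircase_product_opposite:
  "(\<Prod>(i, j) \<in> {(i, j). 1 \<le> i \<and> 1 \<le> j \<and> i + j \<le> n}. 1 - x i / (y \<circ> longest_perm n) j) =
   (\<Prod>(i, j) \<in> {(i, j). 1 \<le> i \<and> i < j \<and> j \<le> n}. 1 - x i / y j)"
  for x y :: "nat \<Rightarrow> 'a::field"
  by (rule prod.reindex_bij_witness[where i = "map_prod id (longest_perm n)" and j = "map_prod id (longest_perm n)"])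
    (auto simp: longest_perm_def)

text \<open>
  The right-hand side of the formula for \<open>X\<close>, extended by zero so that it can solve the recursion as
  a function of all arguments.
\<close>

definition lattice_MC ::
  "nat \<Rightarrow> 'a::field \<Rightarrow> (nat \<Rightarrow> nat) \<Rightarrow> (nat \<Rightarrow> 'a) \<Rightarrow> (nat \<Rightarrow> 'a) \<Rightarrow> 'a" where
  "lattice_MC n t w x y =
     (if w permutes {1..n} \<and> generic_point n x y
      then (- t) powi (- int (coxeter_length n w)) *
           partition_function n t id (longest_perm n \<circ> w) x (y \<circ> longest_perm n)
      else 0)"

text \<open>
  Left multiplication by \<open>w\<^sub>0\<close> turns the ascents of \<open>w\<close> into the descents for which the recursion of
  the partition functions holds, and the factor \<open>-t\<close> in it accounts for the change of length. This
  also shows that the recursion has a solution, so no braid relations have to be verified.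
\<close>

lemma is_MC_dual_X_lattice_MC:
  fixes t :: "'a::field"
  assumes t: "t \<noteq> 0"
  shows "is_MC_dual_X n t (lattice_MC n t)"
  unfolding is_MC_dual_X_def
proof (intro conjI allI impI)
  fix x y :: "nat \<Rightarrow> 'a" assume gen: "generic_point n x y"
  have "coxeter_length n id = 0"
    by (simp add: coxeter_length_eq_card_inversions permutes_id del: id_apply)
  then have "lattice_MC n t id x y =
      (\<Prod>(i, j) \<in> {(i, j). 1 \<le> i \<and> 1 \<le> j \<and> i + j \<le> n}. 1 - x i / (y \<circ> longest_perm n) j)"
    using gen by (simp add: lattice_MC_def permutes_id partition_function_longest_perm)
  also have "\<dots> = (\<Prod>(i, j) \<in> {(i, j). 1 \<le> i \<and> i < j \<and> j \<le> n}. 1 - x i / y j)"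
    by (rule staircase_product_opposite)
  finally show "lattice_MC n t id x y = (\<Prod>(i, j) \<in> {(i, j). 1 \<le> i \<and> i < j \<and> j \<le> n}. 1 - x i / y j)" .
next
  fix w i and x y :: "nat \<Rightarrow> 'a"
  assume w: "w permutes {1..n}" and i: "i \<in> {1..<n}" and gen: "generic_point n x y"
    and less: "bruhat_less n w (w \<circ> simple_reflection i)"
  let ?y = "y \<circ> longest_perm n" and ?w = "longest_perm n \<circ> w" and ?l = "coxeter_length n w"
  have asc: "w i < w (Suc i)"
    using bruhat_less_simple_reflection_iff[OF w i] less by simp
  have in_range: "w i \<in> {1..n}" "w (Suc i) \<in> {1..n}"
    using permutes_in_image[OF w] i by auto
  have desc: "?w (Suc i) < ?w i"
    using asc in_range by (simp add: longest_perm_less_iff)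
  have pf: "partition_function n t id (?w \<circ> simple_reflection i) x ?y =
      - t * T_dual t i (partition_function n t id ?w) x ?y"
    by (rule partition_function_T_dual[OF permutes_compose[OF w longest_perm_permutes] i desc t gen])
  have gen': "generic_point n (x \<circ> simple_reflection i) y"
    by (rule generic_point_simple_reflection[OF gen i])
  have "lattice_MC n t (w \<circ> simple_reflection i) x y =
      (- t) powi (- int (Suc ?l)) * partition_function n t id (?w \<circ> simple_reflection i) x ?y"
    using permutes_compose_simple_reflection[OF w i] gen coxeter_length_ascent[OF w i asc]
    by (simp add: lattice_MC_def comp_assoc)
  also have "\<dots> = (- t) powi (- int (Suc ?l)) * (- t) * T_dual t i (partition_function n t id ?w) x ?y"
    unfolding pf by (simp only: mult.assoc)
  also have "(- t) powi (- int (Suc ?l)) * (- t) = (- t) powi (- int ?l)"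
    using t by (simp only: power_int_minus power_int_of_nat power_Suc) simp
  also have "(- t) powi (- int ?l) * T_dual t i (partition_function n t id ?w) x ?y = T_dual t i (lattice_MC n t w) x y"
    using w gen gen' by (simp add: T_dual_def lattice_MC_def algebra_simps)
  finally show "lattice_MC n t (w \<circ> simple_reflection i) x y = T_dual t i (lattice_MC n t w) x y" .
qed (auto simp: lattice_MC_def)

lemma MC_dual_X_eq_lattice_MC:
  assumes "t \<noteq> 0"
  shows "MC_dual_X n t = lattice_MC n t"
  unfolding MC_dual_X_def
  using is_MC_dual_X_lattice_MC[OF assms] is_MC_dual_X_unique by (intro the_equality) blast+

text \<open>
  The involution that interchanges the defining recursions of the classes for \<open>X\<close> and \<open>Y\<close>.
\<close>

definition opposite ::
  "nat \<Rightarrow> ((nat \<Rightarrow> nat) \<Rightarrow> (nat \<Rightarrow> 'a) \<Rightarrow> (nat \<Rightarrow> 'a) \<Rightarrow> 'a) \<Rightarrow> (nat \<Rightarrow> nat) \<Rightarrow> (nat \<Rightarrow> 'a) \<Rightarrow> (nat \<Rightarrow> 'a) \<Rightarrow> 'a"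
where
  "opposite n M w x y = M (longest_perm n \<circ> w) x (y \<circ> longest_perm n)"

lemma longest_perm_comp_cancel [simp]:
  "longest_perm n \<circ> (longest_perm n \<circ> w) = w" "y \<circ> longest_perm n \<circ> longest_perm n = y"
  by (simp_all add: fun_eq_iff)

lemma opposite_opposite [simp]: "opposite n (opposite n M) = M"
  by (intro ext) (simp add: opposite_def)

lemma permutes_longest_perm_comp_iff: "longest_perm n \<circ> w permutes {1..n} \<longleftrightarrow> w permutes {1..n}"
  using permutes_compose[OF _ longest_perm_permutes, of w n]
    permutes_compose[OF _ longest_perm_permutes, of "longest_perm n \<circ> w" n] by auto

lemma generic_point_longest_perm_iff: "generic_point n x (y \<circ> longest_perm n) \<longleftrightarrow> generic_point n x y"
  using generic_point_longest_perm[of n x y] generic_point_longest_perm[of n x "y \<circ> longest_perm n"] by auto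

lemma bruhat_less_longest_perm_comp:
  assumes w: "w permutes {1..n}" and i: "i \<in> {1..<n}"
  shows "bruhat_less n (longest_perm n \<circ> w \<circ> simple_reflection i) (longest_perm n \<circ> w) \<longleftrightarrow>
         bruhat_less n w (w \<circ> simple_reflection i)"
proof -
  let ?u = "longest_perm n \<circ> w \<circ> simple_reflection i"
  have u: "?u permutes {1..n}"
    using permutes_compose_simple_reflection[OF permutes_compose[OF w longest_perm_permutes] i] .
  have "?u \<circ> simple_reflection i = longest_perm n \<circ> w"
    by (simp add: fun_eq_iff)
  then have "bruhat_less n ?u (longest_perm n \<circ> w) \<longleftrightarrow> ?u i < ?u (Suc i)"
    using bruhat_less_simple_reflection_iff[OF u i] by simp
  also have "\<dots> \<longleftrightarrow> w i < w (Suc i)"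
    using permutes_in_image[OF w] i by (simp add: longest_perm_less_iff)
  finally show ?thesis
    using bruhat_less_simple_reflection_iff[OF w i] by simp
qed

lemma is_MC_dual_X_opposite:
  fixes t :: "'a::field"
  assumes M: "is_MC_dual_Y n t M"
  shows "is_MC_dual_X n t (opposite n M)"
  unfolding is_MC_dual_X_def
proof (intro conjI allI impI)
  fix x y :: "nat \<Rightarrow> 'a" assume "generic_point n x y"
  then have "opposite n M id x y =
      (\<Prod>(i, j) \<in> {(i, j). 1 \<le> i \<and> 1 \<le> j \<and> i + j \<le> n}. 1 - x i / (y \<circ> longest_perm n) j)"
    using M generic_point_longest_perm_iff[of n x y] by (simp add: opposite_def is_MC_dual_Y_def)
  then show "opposite n M id x y = (\<Prod>(i, j) \<in> {(i, j). 1 \<le> i \<and> i < j \<and> j \<le> n}. 1 - x i / y j)"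
    by (simp only: staircase_product_opposite)
next
  fix w i and x y :: "nat \<Rightarrow> 'a"
  assume w: "w permutes {1..n}" and i: "i \<in> {1..<n}" and gen: "generic_point n x y"
    and less: "bruhat_less n w (w \<circ> simple_reflection i)"
  have rec: "M (u \<circ> simple_reflection i) x z = T_dual t i (M u) x z"
    if "u permutes {1..n}" "bruhat_less n (u \<circ> simple_reflection i) u" "generic_point n x z" for u z
    using M i that unfolding is_MC_dual_Y_def by blast
  have "M (longest_perm n \<circ> w \<circ> simple_reflection i) x (y \<circ> longest_perm n) =
      T_dual t i (M (longest_perm n \<circ> w)) x (y \<circ> longest_perm n)"
  proof (rule rec)
    show "longest_perm n \<circ> w permutes {1..n}"
      using w by (simp only: permutes_longest_perm_comp_iff)
    show "bruhat_less n (longest_perm n \<circ> w \<circ> simple_reflection i) (longest_perm n \<circ> w)"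
      using less by (simp only: bruhat_less_longest_perm_comp[OF w i])
    show "generic_point n x (y \<circ> longest_perm n)"
      using gen by (simp only: generic_point_longest_perm_iff)
  qed
  then show "opposite n M (w \<circ> simple_reflection i) x y = T_dual t i (opposite n M w) x y"
    by (simp add: opposite_def T_dual_def comp_assoc)
next
  fix w and x y :: "nat \<Rightarrow> 'a" assume "\<not> (w permutes {1..n} \<and> generic_point n x y)"
  then have "\<not> (longest_perm n \<circ> w permutes {1..n} \<and> generic_point n x (y \<circ> longest_perm n))"
    by (simp only: permutes_longest_perm_comp_iff generic_point_longest_perm_iff simp_thms)
  then show "opposite n M w x y = 0"
    using M unfolding is_MC_dual_Y_def opposite_def by blast
qed

lemma is_MC_dual_Y_opposite:
  fixes t :: "'a::field"
  assumes M: "is_MC_dual_X n t M"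
  shows "is_MC_dual_Y n t (opposite n M)"
  unfolding is_MC_dual_Y_def
proof (intro conjI allI impI)
  fix x y :: "nat \<Rightarrow> 'a" assume "generic_point n x y"
  then have "opposite n M (longest_perm n) x y =
      (\<Prod>(i, j) \<in> {(i, j). 1 \<le> i \<and> i < j \<and> j \<le> n}. 1 - x i / (y \<circ> longest_perm n) j)"
    using M generic_point_longest_perm_iff[of n x y] by (simp add: opposite_def is_MC_dual_X_def)
  also have "\<dots> = (\<Prod>(i, j) \<in> {(i, j). 1 \<le> i \<and> 1 \<le> j \<and> i + j \<le> n}. 1 - x i / y j)"
    using staircase_product_opposite[of x "y \<circ> longest_perm n" n] by simp
  finally show "opposite n M (longest_perm n) x y =
      (\<Prod>(i, j) \<in> {(i, j). 1 \<le> i \<and> 1 \<le> j \<and> i + j \<le> n}. 1 - x i / y j)" .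
next
  fix w i and x y :: "nat \<Rightarrow> 'a"
  assume w: "w permutes {1..n}" and i: "i \<in> {1..<n}" and gen: "generic_point n x y"
    and less: "bruhat_less n (w \<circ> simple_reflection i) w"
  have u: "longest_perm n \<circ> w permutes {1..n}"
    using w permutes_longest_perm_comp_iff by blast
  have "bruhat_less n (longest_perm n \<circ> w) (longest_perm n \<circ> w \<circ> simple_reflection i)"
    using bruhat_less_longest_perm_comp[OF u i] less by simp
  moreover have "generic_point n x (y \<circ> longest_perm n)"
    using gen by (simp only: generic_point_longest_perm_iff)
  ultimately have "M (longest_perm n \<circ> w \<circ> simple_reflection i) x (y \<circ> longest_perm n) =
      T_dual t i (M (longest_perm n \<circ> w)) x (y \<circ> longest_perm n)"
    using M u i unfolding is_MC_dual_X_def by blast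
  then show "opposite n M (w \<circ> simple_reflection i) x y = T_dual t i (opposite n M w) x y"
    by (simp add: opposite_def T_dual_def comp_assoc)
next
  fix w and x y :: "nat \<Rightarrow> 'a" assume "\<not> (w permutes {1..n} \<and> generic_point n x y)"
  then have "\<not> (longest_perm n \<circ> w permutes {1..n} \<and> generic_point n x (y \<circ> longest_perm n))"
    by (simp only: permutes_longest_perm_comp_iff generic_point_longest_perm_iff simp_thms)
  then show "opposite n M w x y = 0"
    using M unfolding is_MC_dual_X_def opposite_def by blast
qed

lemma MC_dual_Y_eq_opposite_lattice_MC:
  assumes "t \<noteq> 0"
  shows "MC_dual_Y n t = opposite n (lattice_MC n t)"
  unfolding MC_dual_Y_def
proof (rule the_equality)
  show "is_MC_dual_Y n t (opposite n (lattice_MC n t))"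
    using is_MC_dual_Y_opposite is_MC_dual_X_lattice_MC[OF assms] by blast
next
  fix M assume "is_MC_dual_Y n t M"
  then have "opposite n M = lattice_MC n t"
    using is_MC_dual_X_opposite is_MC_dual_X_unique is_MC_dual_X_lattice_MC[OF assms] by blast
  then show "M = opposite n (lattice_MC n t)"
    using opposite_opposite by metis
qed

lemma coxeter_length_inv_comp_longest_perm:
  assumes "w permutes {1..n}"
  shows "coxeter_length n (inv w \<circ> longest_perm n) = coxeter_length n (longest_perm n \<circ> w)"
proof -
  have u: "longest_perm n \<circ> w permutes {1..n}"
    using assms permutes_longest_perm_comp_iff by blast
  have "inv (longest_perm n) = longest_perm n"
    by (rule inv_unique_comp) simp_all
  then have "inv (longest_perm n \<circ> w) = inv w \<circ> longest_perm n"
    using permutes_bij[OF assms] permutes_bij[OF longest_perm_permutes] by (simp add: o_inv_distrib)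
  then show ?thesis
    using coxeter_length_inv[OF u] by simp
qed

theorem theorem5p7:
  fixes n :: nat and w :: "nat \<Rightarrow> nat"
    and t :: "'a::field" and x y :: "nat \<Rightarrow> 'a"
  assumes "w permutes {1..n}"
    and "t \<noteq> 0"
    and "generic_point n x y"
  shows "MC_dual_X n t w x y =
           (- t) powi (- int (coxeter_length n w)) *
           partition_function n t id (longest_perm n \<circ> w) x (y \<circ> longest_perm n)
       \<and> MC_dual_Y n t w x y =
           (- t) powi (- int (coxeter_length n (inv w \<circ> longest_perm n))) *
           partition_function n t id w x y"
proof
  show "MC_dual_X n t w x y =
           (- t) powi (- int (coxeter_length n w)) *
           partition_function n t id (longest_perm n \<circ> w) x (y \<circ> longest_perm n)"
    using assms by (simp add: MC_dual_X_eq_lattice_MC lattice_MC_def)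
  have "longest_perm n \<circ> w permutes {1..n}" "generic_point n x (y \<circ> longest_perm n)"
    using assms permutes_longest_perm_comp_iff generic_point_longest_perm by blast+
  then show "MC_dual_Y n t w x y =
           (- t) powi (- int (coxeter_length n (inv w \<circ> longest_perm n))) *
           partition_function n t id w x y"
    by (simp add: MC_dual_Y_eq_opposite_lattice_MC[OF assms(2)] opposite_def lattice_MC_def
      coxeter_length_inv_comp_longest_perm[OF assms(1)])
qed

end
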